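(* Let $n\ge 1$. The set of monomials $\{\mathfrak{s}(w) : w \in B_n\}$ descends to a spanning set of the vector space $\mathbb{C}[\mathbf{x}_{n\times n}]/I_{B_n}$; that is, the cosets $\mathfrak{s}(w)+I_{B_n}$, $w\in B_n$, span $\mathbb{C}[\mathbf{x}_{n\times n}]/I_{B_n}$ over $\mathbb{C}$.
   Context: $\mathbb{C}[\mathbf{x}_{n\times n}]$ is the polynomial ring in the $n^2$ variables $x_{i,j}$, $1\le i,j\le n$. The ideal $I_{B_n}\subseteq \mathbb{C}[\mathbf{x}_{n\times n}]$ is generated by: $x_{i,j}^3$ for all $i,j$; $x_{i,j}x_{i,j'}$ for all $i$ and $j<j'$; $x_{i,j}x_{i',j}$ for all $j$ and $i<i'$; $\sum_{j=1}^n x_{i,j}^2$ for each $i$; $\sum_{i=1}^n x_{i,j}^2$ for each $j$. For $S\subseteq[n]\times[n]$ put $m(S)=\prod_{(i,j)\in S}x_{i,j}$. A rook placement is a subset of $[n]\times[n]$ with no two points having the same first coordinate and no two having the same second coordinate. Shadow set: for a rook placement $P$, let $P_1$ be the set of points $(i,j)\in P$ such that no other $(i',j')\in P$ has $i'<i$ and $j'<j$; list $P_1=\{(i_1,j_1),\dots,(i_m,j_m)\}$ with $i_1<\dots<i_m$ (then $j_1>\dots>j_m$), and call $(i_{t+1},j_t)$, $1\le t\le m-1$, the corners of $P_1$. Remove $P_1$ from $P$ and repeat with the remaining points until none are left. The shadow set $\mathcal{S}(P)$ is the set of all corners produced in all rounds. The signed permutation group $B_n$ consists of pairs $w=(\sigma,\kappa)$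 with $\sigma\in\mathfrak{S}_n$ and $\kappa:[n]\to\{0,1\}$. Put $\mathrm{neg}(w)=\{(i,\sigma(i)):\kappa(\sigma(i))=1\}$, $\mathrm{pos}(w)=\{(i,\sigma(i)):\kappa(\sigma(i))=0\}$, and $\mathfrak{s}(w)=m(\mathrm{neg}(w))\cdot m(\mathcal{S}(\mathrm{pos}(w)))^2$. *)

theory Defs
  imports
    "HOL-Library.Poly_Mapping"
    "HOL-Combinatorics.Permutations"
    "HOL-Algebra.QuotRing"
    "Jordan_Normal_Form.VS_Connect"
begin

text \<open>Exponent vectors are finitely supported maps from index pairs to \<^typ>\<open>nat\<close>; a polynomial is
  a finitely supported map from exponent vectors to coefficients, with the convolution product
  of \<open>HOL-Library.Poly_Mapping\<close>.  On this type infinitely many variables are available;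
  \<open>poly_ring n\<close> restricts to those with both indices in \<open>{1..n}\<close>.\<close>

type_synonym cpoly = "((nat \<times> nat) \<Rightarrow>\<^sub>0 nat) \<Rightarrow>\<^sub>0 complex"

definition X :: "nat \<Rightarrow> nat \<Rightarrow> cpoly" where
  "X i j = Poly_Mapping.single (Poly_Mapping.single (i, j) 1) 1"

definition Const :: "complex \<Rightarrow> cpoly" where
  "Const c = Poly_Mapping.single 0 c"

definition poly_ring :: "nat \<Rightarrow> cpoly ring" where
  "poly_ring n =
     \<lparr>carrier = {p. \<forall>e \<in> Poly_Mapping.keys p. Poly_Mapping.keys e \<subseteq> {1..n} \<times> {1..n}},
      mult = (*), one = 1, zero = 0, add = (+)\<rparr>"

definition I_B_gens :: "nat \<Rightarrow> cpoly set" where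
  "I_B_gens n =
     {X i j ^ 3 | i j. i \<in> {1..n} \<and> j \<in> {1..n}} \<union>
     {X i j * X i j' | i j j'. i \<in> {1..n} \<and> j \<in> {1..n} \<and> j' \<in> {1..n} \<and> j < j'} \<union>
     {X i j * X i' j | i i' j. i \<in> {1..n} \<and> i' \<in> {1..n} \<and> j \<in> {1..n} \<and> i < i'} \<union>
     {(\<Sum>j = 1..n. X i j ^ 2) | i. i \<in> {1..n}} \<union>
     {(\<Sum>i = 1..n. X i j ^ 2) | j. j \<in> {1..n}}"

definition I_B :: "nat \<Rightarrow> cpoly set" where
  "I_B n = genideal (poly_ring n) (I_B_gens n)"

text \<open>The quotient ring as a complex vector space: its elements are the cosets of \<open>I_B n\<close>, and
  \<open>c\<close> acts as multiplication by the coset of the constant polynomial \<open>c\<close>, i.e.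
  \<open>c \<cdot> (p + I) = c p + I\<close>.\<close>

definition quot_B :: "nat \<Rightarrow> (complex, cpoly set) module" where
  "quot_B n = (let Q = poly_ring n Quot I_B n in
     \<lparr>carrier = carrier Q, mult = mult Q, one = one Q, zero = zero Q, add = add Q,
      smult = (\<lambda>c A. (I_B n +>\<^bsub>poly_ring n\<^esub> Const c) \<otimes>\<^bsub>Q\<^esub> A)\<rparr>)"

definition monom_of :: "(nat \<times> nat) set \<Rightarrow> cpoly" where
  "monom_of S = (\<Prod>(i, j)\<in>S. X i j)"

definition first_layer :: "(nat \<times> nat) set \<Rightarrow> (nat \<times> nat) set" where
  "first_layer P = {(i, j) \<in> P. \<not> (\<exists>(i', j') \<in> P. i' < i \<and> j' < j)}"

text \<open>For a finite set of points with distinct first coordinates, the list \<open>ps\<close> below exists and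
  is unique.\<close>

definition corners :: "(nat \<times> nat) set \<Rightarrow> (nat \<times> nat) set" where
  "corners L = {(fst (ps ! Suc t), snd (ps ! t)) | ps t.
     set ps = L \<and> sorted_wrt (\<lambda>p q. fst p < fst q) ps \<and> Suc t < length ps}"

definition remove_layer :: "(nat \<times> nat) set \<Rightarrow> (nat \<times> nat) set" where
  "remove_layer P = P - first_layer P"

text \<open>Once all points have been removed, further rounds contribute no corners.\<close>

definition shadow_set :: "(nat \<times> nat) set \<Rightarrow> (nat \<times> nat) set" where
  "shadow_set P = (\<Union>k. corners (first_layer ((remove_layer ^^ k) P)))"

text \<open>A permutation of \<open>{1..n}\<close> is extended by the identity, a sign function on \<open>{1..n}\<close> by
  \<^const>\<open>undefined\<close>, so that each signed permutation has exactly one representative.\<close>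

definition signed_perms :: "nat \<Rightarrow> ((nat \<Rightarrow> nat) \<times> (nat \<Rightarrow> nat)) set" where
  "signed_perms n = {\<sigma>. \<sigma> permutes {1..n}} \<times> ({1..n} \<rightarrow>\<^sub>E {0, 1})"

definition neg :: "nat \<Rightarrow> (nat \<Rightarrow> nat) \<times> (nat \<Rightarrow> nat) \<Rightarrow> (nat \<times> nat) set" where
  "neg n = (\<lambda>(\<sigma>, \<kappa>). {(i, \<sigma> i) | i. i \<in> {1..n} \<and> \<kappa> (\<sigma> i) = 1})"

definition pos :: "nat \<Rightarrow> (nat \<Rightarrow> nat) \<times> (nat \<Rightarrow> nat) \<Rightarrow> (nat \<times> nat) set" where
  "pos n = (\<lambda>(\<sigma>, \<kappa>). {(i, \<sigma> i) | i. i \<in> {1..n} \<and> \<kappa> (\<sigma> i) = 0})"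

definition shadow_monom :: "nat \<Rightarrow> (nat \<Rightarrow> nat) \<times> (nat \<Rightarrow> nat) \<Rightarrow> cpoly" where
  "shadow_monom n w = monom_of (neg n w) * monom_of (shadow_set (pos n w)) ^ 2"

lemma X_carrier: "i \<in> {1..n} \<Longrightarrow> j \<in> {1..n} \<Longrightarrow> X i j \<in> carrier (poly_ring n)"
  by (auto simp: X_def poly_ring_def)

lemma Const_carrier: "Const c \<in> carrier (poly_ring n)"
  by (auto simp: Const_def poly_ring_def)

lemma one_carrier: "1 \<in> carrier (poly_ring n)"
  by (auto simp: poly_ring_def)

lemma mult_carrier:
  assumes "p \<in> carrier (poly_ring n)" "q \<in> carrier (poly_ring n)"
  shows "p * q \<in> carrier (poly_ring n)"
proof -
  have "Poly_Mapping.keys e \<subseteq> {1..n} \<times> {1..n}" if e: "e \<in> Poly_Mapping.keys (p * q)" for e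
  proof -
    obtain a b where ab: "e = a + b" "a \<in> Poly_Mapping.keys p" "b \<in> Poly_Mapping.keys q"
      using subsetD[OF keys_mult e] by blast
    have "Poly_Mapping.keys e \<subseteq> Poly_Mapping.keys a \<union> Poly_Mapping.keys b"
      unfolding ab(1) by (rule Poly_Mapping.keys_add)
    then show ?thesis
      using assms ab unfolding poly_ring_def by fastforce
  qed
  then show ?thesis by (simp add: poly_ring_def)
qed

lemma add_carrier:
  assumes "p \<in> carrier (poly_ring n)" "q \<in> carrier (poly_ring n)"
  shows "p + q \<in> carrier (poly_ring n)"
  using assms Poly_Mapping.keys_add[of p q] unfolding poly_ring_def by fastforce

lemma cring_poly_ring: "cring (poly_ring n)"
proof (rule cringI)
  show "abelian_group (poly_ring n)"
  proof (rule abelian_groupI)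
    fix x assume x: "x \<in> carrier (poly_ring n)"
    then have "- x \<in> carrier (poly_ring n)"
      by (simp add: poly_ring_def)
    then show "\<exists>y\<in>carrier (poly_ring n). y \<oplus>\<^bsub>poly_ring n\<^esub> x = \<zero>\<^bsub>poly_ring n\<^esub>"
      by (intro bexI[of _ "- x"]) (auto simp: poly_ring_def)
  next
    fix x y assume "x \<in> carrier (poly_ring n)" "y \<in> carrier (poly_ring n)"
    then show "x \<oplus>\<^bsub>poly_ring n\<^esub> y \<in> carrier (poly_ring n)"
      using add_carrier[of x n y] by (simp add: poly_ring_def)
  qed (auto simp: poly_ring_def algebra_simps)
  show "comm_monoid (poly_ring n)"
  proof (rule comm_monoidI)
    fix x y assume "x \<in> carrier (poly_ring n)" "y \<in> carrier (poly_ring n)"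
    then show "x \<otimes>\<^bsub>poly_ring n\<^esub> y \<in> carrier (poly_ring n)"
      using mult_carrier[of x n y] by (simp add: poly_ring_def)
  qed (auto simp: poly_ring_def algebra_simps)
qed (auto simp: poly_ring_def algebra_simps)

lemma pow_carrier: "p \<in> carrier (poly_ring n) \<Longrightarrow> p ^ k \<in> carrier (poly_ring n)"
  by (induction k) (auto intro: mult_carrier one_carrier)

lemma sum_carrier:
  "(\<And>a. a \<in> A \<Longrightarrow> f a \<in> carrier (poly_ring n)) \<Longrightarrow> sum f A \<in> carrier (poly_ring n)"
  by (induction A rule: infinite_finite_induct) (auto intro: add_carrier, auto simp: poly_ring_def)

lemma prod_carrier:
  "(\<And>a. a \<in> A \<Longrightarrow> f a \<in> carrier (poly_ring n)) \<Longrightarrow> prod f A \<in> carrier (poly_ring n)"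
  by (induction A rule: infinite_finite_induct) (auto intro: mult_carrier one_carrier)

lemma I_B_gens_carrier: "I_B_gens n \<subseteq> carrier (poly_ring n)"
  unfolding I_B_gens_def
  by (auto intro!: pow_carrier mult_carrier sum_carrier X_carrier)

lemma ideal_I_B: "ideal (I_B n) (poly_ring n)"
  unfolding I_B_def
  using ring.genideal_ideal[OF cring.axioms(1)[OF cring_poly_ring] I_B_gens_carrier] .

lemma vectorspace_quot_B: "vectorspace class_ring (quot_B n)"
proof -
  interpret R: cring "poly_ring n" by (rule cring_poly_ring)
  interpret I: ideal "I_B n" "poly_ring n" by (rule ideal_I_B)
  interpret Q: cring "poly_ring n Quot I_B n"
    by (rule I.quotient_is_cring[OF cring_poly_ring])
  let ?Q = "poly_ring n Quot I_B n" and ?c = "\<lambda>c. I_B n +>\<^bsub>poly_ring n\<^esub> Const c"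
  have c: "?c c \<in> carrier ?Q" for c
    using ring_hom_closed[OF I.rcos_ring_hom Const_carrier] .
  have add: "?c (a + b) = ?c a \<oplus>\<^bsub>?Q\<^esub> ?c b" for a b
    using ring_hom_add[OF I.rcos_ring_hom Const_carrier Const_carrier, of a b]
    by (simp add: poly_ring_def Const_def single_add)
  have mult: "?c (a * b) = ?c a \<otimes>\<^bsub>?Q\<^esub> ?c b" for a b
    using ring_hom_mult[OF I.rcos_ring_hom Const_carrier Const_carrier, of a b]
    by (simp add: poly_ring_def Const_def mult_single)
  have one: "?c 1 = \<one>\<^bsub>?Q\<^esub>"
    using ring_hom_one[OF I.rcos_ring_hom]
    by (simp add: poly_ring_def Const_def flip: single_one)
  have simps: "carrier (quot_B n) = carrier ?Q" "monoid.mult (quot_B n) = monoid.mult ?Q"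
      "monoid.one (quot_B n) = monoid.one ?Q"
      "ring.zero (quot_B n) = ring.zero ?Q" "ring.add (quot_B n) = ring.add ?Q"
      "\<And>a A. a \<odot>\<^bsub>quot_B n\<^esub> A = ?c a \<otimes>\<^bsub>?Q\<^esub> A"
    by (simp_all add: quot_B_def Let_def)
  have "module class_ring (quot_B n)"
  proof (rule moduleI)
    show "cring (class_ring :: complex ring)" by (rule class_cring.is_cring)
    show "abelian_group (quot_B n)"
    proof (rule abelian_groupI)
      fix x assume "x \<in> carrier (quot_B n)"
      then show "\<exists>y\<in>carrier (quot_B n). y \<oplus>\<^bsub>quot_B n\<^esub> x = \<zero>\<^bsub>quot_B n\<^esub>"
        unfolding simps by (meson Q.l_neg Q.a_inv_closed)
    qed (auto simp: simps Q.a_ac)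
  qed (auto simp: simps c add mult one Q.l_distr Q.r_distr Q.m_assoc)
  then show ?thesis
    by (intro vectorspace.intro class_field)
qed

lemma shadow_set_subset: "shadow_set P \<subseteq> fst ` P \<times> snd ` P"
proof -
  have "(remove_layer ^^ k) P \<subseteq> P" for k
    by (induction k) (auto simp: remove_layer_def)
  moreover have "first_layer Q \<subseteq> Q" for Q
    by (auto simp: first_layer_def)
  moreover have "corners L \<subseteq> fst ` L \<times> snd ` L" for L
    by (force simp: corners_def)
  ultimately have "corners (first_layer ((remove_layer ^^ k) P)) \<subseteq> fst ` P \<times> snd ` P" for k
    by (meson Sigma_mono image_mono subset_trans)
  then show ?thesis
    unfolding shadow_set_def by (rule UN_least)
qed

lemma shadow_monom_carrier:
  assumes "w \<in> signed_perms n"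
  shows "shadow_monom n w \<in> carrier (poly_ring n)"
proof -
  have *: "monom_of S \<in> carrier (poly_ring n)" if "S \<subseteq> {1..n} \<times> {1..n}" for S
    using that unfolding monom_of_def by (auto intro!: prod_carrier X_carrier)
  obtain \<sigma> \<kappa> where w: "w = (\<sigma>, \<kappa>)" "\<sigma> permutes {1..n}"
    using assms by (auto simp: signed_perms_def)
  have \<sigma>: "\<sigma> i \<in> {1..n}" if "i \<in> {1..n}" for i
    using permutes_in_image[OF w(2)] that by blast
  have neg: "neg n w \<subseteq> {1..n} \<times> {1..n}" and pos: "pos n w \<subseteq> {1..n} \<times> {1..n}"
    unfolding neg_def pos_def w(1) using \<sigma> by blast+
  have "fst ` pos n w \<subseteq> {1..n}" "snd ` pos n w \<subseteq> {1..n}"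
    using pos by fastforce+
  then have shadow: "shadow_set (pos n w) \<subseteq> {1..n} \<times> {1..n}"
    using shadow_set_subset[of "pos n w"] by (meson Sigma_mono subset_trans)
  show ?thesis
    unfolding shadow_monom_def by (intro mult_carrier pow_carrier * neg shadow)
qed

lemma span_quot_B:
  "LinearCombinations.module.span class_ring (quot_B n) S =
     {LinearCombinations.module.lincomb (quot_B n) a A | a A. finite A \<and> A \<subseteq> S}"
  using LinearCombinations.module.span_def[OF vectorspace.axioms(1)[OF vectorspace_quot_B[of n]], of S]
  by auto

end

theory Submission
  imports Defs
begin

text \<open>Fix the set \<open>A\<close> of points of multiplicity one in a monomial and let \<open>R\<close>, \<open>C\<close> be the
  complementary rows and columns.  Modulo the ideal, the monomials \<open>m(A) m(B)\<^sup>2\<close> with \<open>B\<close> a rook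
  placement in \<open>R \<times> C\<close> satisfy the row and column relations of the permutation matrix case.

  Inclusion-exclusion on the row relations gives, for a placement \<open>D\<close> and row and column sets \<open>S\<close>, \<open>T\<close>
  disjoint from it with \<open>|S| + |T| + |D| > |C|\<close>, that the sum over all injections \<open>S \<rightarrow> T\<close> added to
  \<open>D\<close> vanishes.  Call a column or row missing if \<open>B\<close> does not meet it.  If \<open>B\<close> contains an increasing
  chain \<open>K\<close> with fewer than \<open>|K|\<close> missing columns to the left of its last point, this applies with
  \<open>D = B - K\<close>, \<open>S\<close> the rows of \<open>K\<close> and \<open>T\<close> the columns of \<open>K\<close> together with the missing columns to the
  right of its last point.  By the rearrangement inequality \<open>B\<close> strictly maximises
  \<open>\<Sum> (N - i) (N - j)\<close> among the terms, so \<open>B\<close> can be rewritten by smaller placements; likewise for rows.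

  If no chain is deficient in this sense, then inverting Viennot's construction from the outermost shadow
  line inwards, with the missing rows and columns as the unbounded rays, never gets stuck and produces a
  bijection \<open>R \<rightarrow> C\<close> with shadow set \<open>B\<close>.\<close>

subsection \<open>Rook placements and matchings\<close>

definition rook :: "(nat \<times> nat) set \<Rightarrow> bool" where
  "rook P \<longleftrightarrow> inj_on fst P \<and> inj_on snd P"

text \<open>\<open>sw\<close> reads south-west, with both coordinates growing to the north-east.
  This strict order decides which points form a first layer.\<close>

definition sw_of :: "nat \<times> nat \<Rightarrow> nat \<times> nat \<Rightarrow> bool" where
  "sw_of p q \<longleftrightarrow> fst p < fst q \<and> snd p < snd q"

definition sw_chain :: "(nat \<times> nat) set \<Rightarrow> bool" where
  "sw_chain K \<longleftrightarrow> (\<forall>p\<in>K. \<forall>q\<in>K. p \<noteq> q \<longrightarrow> sw_of p q \<or> sw_of q p)"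

text \<open>These are the graphs of the injections from \<open>S\<close> into \<open>T\<close>, kept
  as point sets so that they can be united with a placement.\<close>

definition row_matchings :: "nat set \<Rightarrow> nat set \<Rightarrow> (nat \<times> nat) set set" where
  "row_matchings S T = {M. M \<subseteq> S \<times> T \<and> rook M \<and> fst ` M = S}"

lemma rook_subset: "rook P \<Longrightarrow> Q \<subseteq> P \<Longrightarrow> rook Q"
  unfolding rook_def using inj_on_subset by blast

lemma rook_fst_eq: "rook P \<Longrightarrow> (i, j) \<in> P \<Longrightarrow> (i, j') \<in> P \<Longrightarrow> j = j'"
  unfolding rook_def by (metis fst_conv inj_onD prod.inject)

lemma rook_snd_eq: "rook P \<Longrightarrow> (i, j) \<in> P \<Longrightarrow> (i', j) \<in> P \<Longrightarrow> i = i'"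
  unfolding rook_def by (metis snd_conv inj_onD prod.inject)

lemma rookI:
  assumes "\<And>i j j'. (i, j) \<in> P \<Longrightarrow> (i, j') \<in> P \<Longrightarrow> j = j'"
    and "\<And>i i' j. (i, j) \<in> P \<Longrightarrow> (i', j) \<in> P \<Longrightarrow> i = i'"
  shows "rook P"
  unfolding rook_def inj_on_def using assms by force

lemma rook_insert:
  "rook P \<Longrightarrow> i \<notin> fst ` P \<Longrightarrow> j \<notin> snd ` P \<Longrightarrow> rook (insert (i, j) P)"
  unfolding rook_def by (auto simp: inj_on_def)

lemma rook_Un:
  assumes "rook P" "rook Q" "fst ` P \<inter> fst ` Q = {}" "snd ` P \<inter> snd ` Q = {}"
  shows "rook (P \<union> Q)"
  using assms unfolding rook_def by (auto simp: inj_on_Un)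

lemma card_fst_rook: "rook P \<Longrightarrow> card (fst ` P) = card P"
  and card_snd_rook: "rook P \<Longrightarrow> card (snd ` P) = card P"
  by (auto simp: rook_def card_image)

lemma rook_swap: "rook (prod.swap ` P) \<longleftrightarrow> rook P"
proof -
  have "inj_on fst (prod.swap ` P) \<longleftrightarrow> inj_on snd P" "inj_on snd (prod.swap ` P) \<longleftrightarrow> inj_on fst P"
    using comp_inj_on_iff[of prod.swap P fst] comp_inj_on_iff[of prod.swap P snd]
    by (simp_all add: comp_def)
  then show ?thesis unfolding rook_def by blast
qed

section \<open>Sums over injections from rows to columns\<close>

lemma finite_row_matchings: "finite S \<Longrightarrow> finite T \<Longrightarrow> finite (row_matchings S T)"
  unfolding row_matchings_def by (rule finite_subset[of _ "Pow (S \<times> T)"]) auto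

lemma row_matchings_remove:
  assumes "M \<in> row_matchings S T" "(i, j) \<in> M"
  shows "M - {(i, j)} \<in> row_matchings (S - {i}) (T - {j})"
proof -
  have *: "M \<subseteq> S \<times> T" "rook M" "fst ` M = S"
    using assms by (auto simp: row_matchings_def)
  have "M - {(i, j)} \<subseteq> (S - {i}) \<times> (T - {j})"
    using * assms(2) rook_fst_eq[OF *(2)] rook_snd_eq[OF *(2)] by blast
  moreover have "fst ` (M - {(i, j)}) = S - {i}"
    using *(2,3) assms(2) inj_on_image_set_diff[of fst M M "{(i, j)}"] by (simp add: rook_def)
  ultimately show ?thesis
    using rook_subset[OF *(2)] by (auto simp: row_matchings_def)
qed

lemma row_matchings_insert:
  assumes "M \<in> row_matchings S T" "i \<notin> S" "j \<notin> snd ` M"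
  shows "insert (i, j) M \<in> row_matchings (insert i S) (insert j T)"
  using assms rook_insert[of M i j] by (auto simp: row_matchings_def)

lemma row_matchings_mono: "T \<subseteq> T' \<Longrightarrow> M \<in> row_matchings S T \<Longrightarrow> M \<in> row_matchings S T'"
  by (auto simp: row_matchings_def)

text \<open>An injection on \<open>insert i S\<close> amounts to its restriction to \<open>S\<close>
  together with an image of \<open>i\<close> outside the range of that restriction; \<open>h\<close>
  is this bijection.\<close>

lemma sum_row_matchings_insert_row:
  fixes g :: "(nat \<times> nat) set \<Rightarrow> 'a::comm_monoid_add"
  assumes fin: "finite S" "finite T" and i: "i \<notin> S"
  shows "sum g (row_matchings (insert i S) T) =
    (\<Sum>M\<in>row_matchings S T. \<Sum>j\<in>T - snd ` M. g (insert (i, j) M))"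
proof -
  define A where "A = Sigma (row_matchings S T) (\<lambda>M. T - snd ` M)"
  define h where "h = (\<lambda>(M :: (nat \<times> nat) set, j). insert (i, j :: nat) M)"
  have sub: "M \<subseteq> S \<times> T" if "M \<in> row_matchings S T" for M
    using that by (simp add: row_matchings_def)
  have inj: "inj_on h A"
  proof (rule inj_onI, clarify)
    fix M j M' j' assume a: "(M, j) \<in> A" "(M', j') \<in> A" "h (M, j) = h (M', j')"
    have eq: "insert (i, j) M = insert (i, j') M'" using a by (simp add: h_def)
    have s: "M \<subseteq> S \<times> T" "M' \<subseteq> S \<times> T" using a sub by (auto simp: A_def)
    have n: "\<And>j. (i, j) \<notin> M" "\<And>j. (i, j) \<notin> M'" using s i by auto
    have "j = j'" using eq n by blast
    moreover have "M = M'" using eq n \<open>j = j'\<close> by (metis insert_ident)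
    ultimately show "M = M' \<and> j = j'" by simp
  qed
  have im: "h ` A = row_matchings (insert i S) T"
  proof
    show "h ` A \<subseteq> row_matchings (insert i S) T"
    proof clarify
      fix M j assume "(M, j) \<in> A"
      then have "M \<in> row_matchings S T" "j \<in> T" "j \<notin> snd ` M" by (auto simp: A_def)
      then show "h (M, j) \<in> row_matchings (insert i S) T"
        using row_matchings_insert[of M S T i j] i by (simp add: h_def insert_absorb)
    qed
    show "row_matchings (insert i S) T \<subseteq> h ` A"
    proof
      fix M assume M: "M \<in> row_matchings (insert i S) T"
      then obtain j where j: "(i, j) \<in> M" by (force simp: row_matchings_def)
      have *: "M - {(i, j)} \<in> row_matchings S (T - {j})"
        using row_matchings_remove[OF M j] i by simp
      then have "M - {(i, j)} \<in> row_matchings S T"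
        by (rule row_matchings_mono[rotated]) auto
      moreover have "j \<in> T - snd ` (M - {(i, j)})"
        using M j sub[of "M - {(i, j)}"] * by (auto simp: row_matchings_def)
      moreover have "M = h (M - {(i, j)}, j)"
        using j by (auto simp: h_def)
      ultimately show "M \<in> h ` A" unfolding A_def by blast
    qed
  qed
  have "sum g (row_matchings (insert i S) T) = sum (g \<circ> h) A"
    using sum.reindex[OF inj, of g] im by simp
  also have "\<dots> = (\<Sum>M\<in>row_matchings S T. \<Sum>j\<in>T - snd ` M. g (insert (i, j) M))"
    unfolding A_def using fin finite_row_matchings[OF fin]
    by (subst sum.Sigma) (auto simp: h_def intro!: sum.cong)
  finally show ?thesis .
qed

text \<open>An injection into \<open>insert c T\<close> either avoids \<open>c\<close> or takes it
  at exactly one row \<open>i\<close>, and deleting that point leaves an injection of the other rows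
  into \<open>T\<close>. This is the inclusion-exclusion step.\<close>

lemma sum_row_matchings_insert_col:
  fixes g :: "(nat \<times> nat) set \<Rightarrow> 'a::comm_monoid_add"
  assumes fin: "finite S" "finite T" and c: "c \<notin> T"
  shows "sum g (row_matchings S (insert c T)) =
    sum g (row_matchings S T) + (\<Sum>i\<in>S. \<Sum>M\<in>row_matchings (S - {i}) T. g (insert (i, c) M))"
proof -
  define A where "A = Sigma S (\<lambda>i. row_matchings (S - {i}) T)"
  define h where "h = (\<lambda>(i :: nat, M :: (nat \<times> nat) set). insert (i, c) M)"
  have sub: "M \<subseteq> (S - {i}) \<times> T" if "(i, M) \<in> A" for i M
    using that by (simp add: A_def row_matchings_def)
  have cM: "c \<notin> snd ` M" if "(i, M) \<in> A" for i M
    using sub[OF that] c by auto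
  have inj: "inj_on h A"
  proof (rule inj_onI, clarify)
    fix M i M' i' assume a: "(i, M) \<in> A" "(i', M') \<in> A" "h (i, M) = h (i', M')"
    have eq: "insert (i, c) M = insert (i', c) M'" using a by (simp add: h_def)
    have n: "\<And>i. (i, c) \<notin> M" "\<And>i. (i, c) \<notin> M'" using cM a by force+
    have "i = i'" using eq n by blast
    moreover have "M = M'" using eq n \<open>i = i'\<close> by (metis insert_ident)
    ultimately show "i = i' \<and> M = M'" by simp
  qed
  have disj: "row_matchings S T \<inter> h ` A = {}"
    using c by (auto simp: h_def row_matchings_def)
  have im: "row_matchings S (insert c T) = row_matchings S T \<union> h ` A"
  proof
    show "row_matchings S T \<union> h ` A \<subseteq> row_matchings S (insert c T)"
    proof (intro Un_least subsetI)
      fix M assume "M \<in> row_matchings S T"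
      then show "M \<in> row_matchings S (insert c T)"
        by (rule row_matchings_mono[rotated]) auto
    next
      fix M' assume "M' \<in> h ` A"
      then obtain i M where M: "(i, M) \<in> A" "M' = insert (i, c) M" by (auto simp: h_def)
      then have "i \<in> S" "M \<in> row_matchings (S - {i}) T" by (auto simp: A_def)
      then show "M' \<in> row_matchings S (insert c T)"
        using row_matchings_insert[of M "S - {i}" T i c] cM[OF M(1)] M(2)
        by (simp add: insert_absorb)
    qed
    show "row_matchings S (insert c T) \<subseteq> row_matchings S T \<union> h ` A"
    proof
      fix M assume M: "M \<in> row_matchings S (insert c T)"
      show "M \<in> row_matchings S T \<union> h ` A"
      proof (cases "c \<in> snd ` M")
        case False
        then have "M \<in> row_matchings S T" using M by (force simp: row_matchings_def)
        then show ?thesis by simp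
      next
        case True
        then obtain i where i: "(i, c) \<in> M" by force
        then have "i \<in> S" using M by (auto simp: row_matchings_def)
        moreover have "M - {(i, c)} \<in> row_matchings (S - {i}) T"
          using row_matchings_remove[OF M i] c by simp
        moreover have "M = h (i, M - {(i, c)})" using i by (auto simp: h_def)
        ultimately show ?thesis unfolding A_def by blast
      qed
    qed
  qed
  have fA: "finite A" unfolding A_def using fin finite_row_matchings by auto
  have "sum g (row_matchings S (insert c T)) = sum g (row_matchings S T) + sum g (h ` A)"
    unfolding im using fin finite_row_matchings fA disj by (intro sum.union_disjoint) auto
  also have "sum g (h ` A) = sum (g \<circ> h) A" by (rule sum.reindex[OF inj])
  also have "\<dots> = (\<Sum>i\<in>S. \<Sum>M\<in>row_matchings (S - {i}) T. g (insert (i, c) M))"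
    unfolding A_def using fin finite_row_matchings
    by (subst sum.Sigma) (auto simp: h_def intro!: sum.cong)
  finally show ?thesis .
qed

subsection \<open>Straightening\<close>

text \<open>Instances of \<open>V\<close> are the ideal and the preimage of the span under the
  quotient map; straightening only adds and subtracts members.\<close>

locale add_subgroup =
  fixes V :: "'a::ab_group_add set"
  assumes zero_mem: "0 \<in> V"
    and diff_mem: "x \<in> V \<Longrightarrow> y \<in> V \<Longrightarrow> x - y \<in> V"
begin

lemma add_mem: "x \<in> V \<Longrightarrow> y \<in> V \<Longrightarrow> x + y \<in> V"
  using diff_mem[of x "0 - y"] diff_mem[of 0 y] zero_mem by simp

lemma sum_mem: "(\<And>a. a \<in> A \<Longrightarrow> f a \<in> V) \<Longrightarrow> sum f A \<in> V"
  by (induction A rule: infinite_finite_induct) (auto simp: zero_mem add_mem)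

end

text \<open>Induction on the number of columns outside \<open>T\<close> that \<open>D\<close> leaves
  free. If there are none, the sum splits into row relations. Otherwise a free column
  \<open>c\<close> is added to \<open>T\<close>, and the injections using \<open>c\<close> at some
  row \<open>i\<close> are subtracted; for these the point \<open>(i, c)\<close> moves into
  \<open>D\<close>.\<close>

lemma (in add_subgroup) row_matchings_sum_mem:
  assumes fin: "finite R" "finite C"
    and rel: "\<And>B i. B \<subseteq> R \<times> C \<Longrightarrow> rook B \<Longrightarrow> i \<in> R - fst ` B \<Longrightarrow>
      (\<Sum>j\<in>C - snd ` B. Y (insert (i, j) B)) \<in> V"
    and "D \<subseteq> R \<times> C" "rook D" "S \<subseteq> R - fst ` D" "T \<subseteq> C - snd ` D"
    and "card C < card S + card T + card D"
  shows "(\<Sum>M\<in>row_matchings S T. Y (D \<union> M)) \<in> V"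
  using assms(4-8)
proof (induction "card (C - snd ` D - T)" arbitrary: D S T rule: less_induct)
  case less
  note D = less.prems(1,2) and S = less.prems(3) and T = less.prems(4)
  have finST: "finite S" "finite T" "finite D"
    using S T D fin by (meson finite_Diff finite_subset finite_SigmaI)+
  show ?case
  proof (cases "T = C - snd ` D")
    case True
    have sD: "snd ` D \<subseteq> C" using D(1) by auto
    have "card T = card C - card D"
      using True card_Diff_subset[of "snd ` D" C] sD finST card_snd_rook[OF D(2)] by simp
    moreover have "card D \<le> card C"
      using card_mono[OF fin(2) sD] card_snd_rook[OF D(2)] by simp
    \<comment> \<open>\<open>T\<close> and \<open>D\<close> now use up all of \<open>C\<close>, so
      the cardinality bound leaves \<open>S\<close> nonempty and supplies a row for the
      relation.\<close>
    ultimately have "S \<noteq> {}" using less.prems(5) by auto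
    then obtain i where i: "i \<in> S" by auto
    have "(\<Sum>M\<in>row_matchings (insert i (S - {i})) T. Y (D \<union> M)) =
      (\<Sum>M\<in>row_matchings (S - {i}) T. \<Sum>j\<in>T - snd ` M. Y (D \<union> insert (i, j) M))"
      using finST by (intro sum_row_matchings_insert_row) auto
    moreover have "(\<Sum>j\<in>T - snd ` M. Y (D \<union> insert (i, j) M)) \<in> V"
      if M: "M \<in> row_matchings (S - {i}) T" for M
    proof -
      have M': "M \<subseteq> (S - {i}) \<times> T" "rook M" "fst ` M = S - {i}"
        using M by (auto simp: row_matchings_def)
      then have sM: "snd ` M \<subseteq> T" by auto
      have "T - snd ` M = C - snd ` (D \<union> M)" using True by auto
      moreover have "rook (D \<union> M)"
        using M'(3) sM S T by (intro rook_Un D(2) M'(2)) blast+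
      moreover have "D \<union> M \<subseteq> R \<times> C" using D(1) M'(1) S T by blast
      moreover have "i \<in> R - fst ` (D \<union> M)" using i S M'(3) by (auto simp: image_Un)
      ultimately show ?thesis using rel[of "D \<union> M" i] by simp
    qed
    ultimately show ?thesis using i by (simp add: insert_absorb sum_mem)
  next
    case False
    then obtain c where c: "c \<in> C" "c \<notin> snd ` D" "c \<notin> T" using T by auto
    have "card (C - snd ` D - insert c T) < card (C - snd ` D - T)"
      using c fin by (intro psubset_card_mono) auto
    then have 1: "(\<Sum>M\<in>row_matchings S (insert c T). Y (D \<union> M)) \<in> V"
      using less.prems c finST by (intro less.hyps) auto
    have 2: "(\<Sum>M\<in>row_matchings (S - {i}) T. Y (D \<union> insert (i, c) M)) \<in> V" if i: "i \<in> S" for i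
    proof -
      have iD: "i \<notin> fst ` D" using i S by auto
      have "card (C - snd ` (insert (i, c) D) - T) < card (C - snd ` D - T)"
        using c fin by (intro psubset_card_mono) auto
      moreover have "rook (insert (i, c) D)" using rook_insert[OF D(2) iD c(2)] .
      \<comment> \<open>The row lost by \<open>S\<close> is made up for by the point gained by
        \<open>D\<close>, so the cardinality bound survives.\<close>
      moreover have "card S = Suc (card (S - {i}))"
        using i finST by (metis card_Suc_Diff1)
      moreover have "card (insert (i, c) D) = Suc (card D)"
        using iD finST by (subst card_insert_disjoint) force+
      ultimately have "(\<Sum>M\<in>row_matchings (S - {i}) T. Y (insert (i, c) D \<union> M)) \<in> V"
        using less.prems c i by (intro less.hyps) auto
      then show ?thesis by simp
    qed
    have "(\<Sum>M\<in>row_matchings S T. Y (D \<union> M)) = (\<Sum>M\<in>row_matchings S (insert c T). Y (D \<union> M))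
        - (\<Sum>i\<in>S. \<Sum>M\<in>row_matchings (S - {i}) T. Y (D \<union> insert (i, c) M))"
      using sum_row_matchings_insert_col[OF finST(1,2) c(3), of "\<lambda>M. Y (D \<union> M)"] by simp
    moreover have "(\<Sum>i\<in>S. \<Sum>M\<in>row_matchings (S - {i}) T. Y (D \<union> insert (i, c) M)) \<in> V"
      by (rule sum_mem) (rule 2)
    ultimately show ?thesis using diff_mem[OF 1] by simp
  qed
qed

section \<open>Weights and the rearrangement inequality\<close>

text \<open>Where weights are compared strictly, \<open>N\<close> exceeds every row and column
  involved. All factors are then positive, and moving a point to a smaller column strictly raises
  the weight.\<close>

definition weight :: "nat \<Rightarrow> (nat \<times> nat) set \<Rightarrow> nat" where
  "weight N P = (\<Sum>(i, j)\<in>P. (N - i) * (N - j))"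

lemma weight_swap: "weight N (prod.swap ` P) = weight N P"
  unfolding weight_def by (subst sum.reindex) (auto simp: case_prod_beta mult.commute intro!: sum.cong)

lemma weight_Un: "finite P \<Longrightarrow> finite Q \<Longrightarrow> P \<inter> Q = {} \<Longrightarrow> weight N (P \<union> Q) = weight N P + weight N Q"
  unfolding weight_def by (rule sum.union_disjoint)

lemma weight_insert: "finite P \<Longrightarrow> (i, j) \<notin> P \<Longrightarrow> weight N (insert (i, j) P) = (N - i) * (N - j) + weight N P"
  unfolding weight_def by simp

lemma sw_chain_fst_less:
  "sw_chain K \<Longrightarrow> (i, j) \<in> K \<Longrightarrow> (i', j') \<in> K \<Longrightarrow> j < j' \<Longrightarrow> i < i'"
  unfolding sw_chain_def sw_of_def by force

lemma sw_chain_rook: "sw_chain K \<Longrightarrow> rook K"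
  unfolding sw_chain_def sw_of_def by (intro rookI) force+

lemma rearrangement_aux:
  fixes a a' b b' :: nat
  assumes "a' < a" "b' < b"
  shows "a * b' + a' * b < a * b + a' * b'"
proof -
  obtain x y where "a = a' + Suc x" "b = b' + Suc y"
    using assms by (metis less_imp_Suc_add add_Suc_right)
  then show ?thesis by (simp add: algebra_simps)
qed

text \<open>An exchange step: at the first row where \<open>M\<close> deviates from \<open>K\<close>, the column used by \<open>M\<close> is
  too large, and moving it to the column used by \<open>K\<close> increases the weight.\<close>

lemma row_matching_improve:
  assumes K: "sw_chain K" and fin: "finite K" "finite T'"
    and T': "\<And>p c. p \<in> K \<Longrightarrow> c \<in> T' \<Longrightarrow> snd p < c"
    and N: "\<And>i. i \<in> fst ` K \<union> snd ` K \<union> T' \<Longrightarrow> i < N"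
    and M: "M \<in> row_matchings (fst ` K) (snd ` K \<union> T')" "M \<noteq> K"
  shows "\<exists>M'\<in>row_matchings (fst ` K) (snd ` K \<union> T'). weight N M < weight N M'"
proof -
  have Ms: "M \<subseteq> fst ` K \<times> (snd ` K \<union> T')" "rook M" "fst ` M = fst ` K"
    using M(1) by (auto simp: row_matchings_def)
  have rK: "rook K" by (rule sw_chain_rook[OF K])
  have finM: "finite M" using Ms(1) fin by (meson finite_SigmaI finite_Un finite_imageI finite_subset)
  have "\<exists>s. s \<in> fst ` K \<and> \<not> (\<exists>c. (s, c) \<in> K \<and> (s, c) \<in> M)"
  proof (rule ccontr)
    assume "\<not> ?thesis"
    then have *: "\<And>s. s \<in> fst ` K \<Longrightarrow> \<exists>c. (s, c) \<in> K \<and> (s, c) \<in> M" by blast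
    have "K \<subseteq> M"
    proof
      fix p assume "p \<in> K"
      then show "p \<in> M" using *[of "fst p"] rook_fst_eq[OF rK] by (metis image_eqI prod.collapse)
    qed
    moreover have "M \<subseteq> K"
    proof
      fix p assume p: "p \<in> M"
      then have "fst p \<in> fst ` K" using Ms(3) by auto
      then show "p \<in> K" using *[of "fst p"] rook_fst_eq[OF Ms(2)] p by (metis prod.collapse)
    qed
    ultimately show False using M(2) by simp
  qed
  then have ex: "\<exists>s. (s \<in> fst ` K \<and> \<not> (\<exists>c. (s, c) \<in> K \<and> (s, c) \<in> M)) \<and>
      (\<forall>s'<s. \<not> (s' \<in> fst ` K \<and> \<not> (\<exists>c. (s', c) \<in> K \<and> (s', c) \<in> M)))"
    using exists_least_iff[of "\<lambda>s. s \<in> fst ` K \<and> \<not> (\<exists>c. (s, c) \<in> K \<and> (s, c) \<in> M)"] by blast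
  then obtain s where s: "s \<in> fst ` K" "\<not> (\<exists>c. (s, c) \<in> K \<and> (s, c) \<in> M)"
    and min: "\<And>s'. s' < s \<Longrightarrow> s' \<in> fst ` K \<Longrightarrow> \<exists>c. (s', c) \<in> K \<and> (s', c) \<in> M"
    by blast
  obtain c where c: "(s, c) \<in> K" using s(1) by auto
  obtain d where d: "(s, d) \<in> M" using s(1) Ms(3) by (metis fst_conv imageE prod.collapse)
  have "d \<noteq> c" using s(2) c d by blast
  \<comment> \<open>A smaller \<open>d\<close> would be the column of an earlier row of the chain;
    there \<open>M\<close> agrees with \<open>K\<close>, so \<open>M\<close> would use column
    \<open>d\<close> twice.\<close>
  have "c < d"
  proof (rule ccontr)
    assume "\<not> c < d"
    with \<open>d \<noteq> c\<close> have dc: "d < c" by simp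
    have "d \<notin> T'" using T'[OF c, of d] dc by auto
    then obtain s' where s': "(s', d) \<in> K" using Ms(1) d by force
    have "s' < s" using sw_chain_fst_less[OF K s' c dc] .
    then obtain e where "(s', e) \<in> K" "(s', e) \<in> M" using min s' by force
    then have "(s', d) \<in> M" using rook_fst_eq[OF rK s'] by blast
    then show False using rook_snd_eq[OF Ms(2) d] \<open>s' < s\<close> by blast
  qed
  have lt: "s < N" "c < N" "d < N" 
  proof -
    have "s \<in> fst ` K" "c \<in> snd ` K" "d \<in> snd ` K \<union> T'"
      using s(1) c d Ms(1) by (auto intro: rev_image_eqI)
    then show "s < N" "c < N" "d < N" using N by blast+
  qed
  define M1 where "M1 = M - {(s, d)}"
  have M1: "M1 \<in> row_matchings (fst ` K - {s}) (snd ` K \<union> T' - {d})"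
    unfolding M1_def by (rule row_matchings_remove[OF M(1) d])
  have wM: "weight N M = (N - s) * (N - d) + weight N M1"
    using weight_insert[of M1 s d N] finM d by (simp add: M1_def insert_absorb)
  have fM1: "finite M1" using finM by (simp add: M1_def)
  have cK: "c \<in> snd ` K" using c by force
  \<comment> \<open>Either column \<open>c\<close> is free and the point of row \<open>s\<close>
    moves there, or a later row \<open>u\<close> holds it and the two rows swap columns.\<close>
  show ?thesis
  proof (cases "c \<in> snd ` M1")
    case False
    have "insert (s, c) M1 \<in> row_matchings (insert s (fst ` K - {s})) (insert c (snd ` K \<union> T' - {d}))"
      by (rule row_matchings_insert[OF M1 _ False]) simp
    then have "insert (s, c) M1 \<in> row_matchings (fst ` K) (snd ` K \<union> T')"
      using s(1) cK
      by (intro row_matchings_mono[of "insert c (snd ` K \<union> T' - {d})" "snd ` K \<union> T'"])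
        (auto simp: insert_absorb)
    moreover have "weight N (insert (s, c) M1) = (N - s) * (N - c) + weight N M1"
      using False fM1 by (intro weight_insert) force+
    ultimately show ?thesis
      using wM lt \<open>c < d\<close> by (intro bexI[of _ "insert (s, c) M1"]) auto
  next
    case True
    then obtain u where u: "(u, c) \<in> M1" by force
    then have uM: "(u, c) \<in> M" "u \<noteq> s" using s c by (auto simp: M1_def)
    have "s < u"
    proof (rule ccontr)
      assume "\<not> s < u"
      then have us: "u < s" using uM(2) by simp
      moreover have "u \<in> fst ` K" using uM Ms(1) by auto
      ultimately obtain e where "(u, e) \<in> K" "(u, e) \<in> M" using min by blast
      then have "(u, c) \<in> K" using rook_fst_eq[OF Ms(2) uM(1)] by blast
      then show False using rook_snd_eq[OF rK c] us by blast
    qed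
    have "u < N" using N uM(1) Ms(1) by blast
    define M2 where "M2 = M1 - {(u, c)}"
    have M2: "M2 \<in> row_matchings (fst ` K - {s} - {u}) (snd ` K \<union> T' - {d} - {c})"
      unfolding M2_def by (rule row_matchings_remove[OF M1 u])
    have fM2: "finite M2" using fM1 by (simp add: M2_def)
    have cd: "c \<notin> snd ` M2" "d \<notin> snd ` M2" "s \<notin> fst ` M2" "u \<notin> fst ` M2"
      using M2 by (force simp: row_matchings_def)+
    have M3: "insert (u, d) M2 \<in> row_matchings (insert u (fst ` K - {s} - {u})) (insert d (snd ` K \<union> T' - {d} - {c}))"
      by (rule row_matchings_insert[OF M2 _ cd(2)]) simp
    have "insert (s, c) (insert (u, d) M2) \<in> row_matchings (insert s (insert u (fst ` K - {s} - {u})))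
        (insert c (insert d (snd ` K \<union> T' - {d} - {c})))"
      by (rule row_matchings_insert[OF M3]) (use cd \<open>d \<noteq> c\<close> uM(2) in auto)
    moreover have "insert s (insert u (fst ` K - {s} - {u})) = fst ` K"
      using s(1) uM(1) Ms(1) by auto
    moreover have "insert c (insert d (snd ` K \<union> T' - {d} - {c})) = snd ` K \<union> T'"
      using cK d Ms(1) by auto
    ultimately have "insert (s, c) (insert (u, d) M2) \<in> row_matchings (fst ` K) (snd ` K \<union> T')"
      by simp
    moreover have "weight N (insert (s, c) (insert (u, d) M2)) =
        (N - s) * (N - c) + ((N - u) * (N - d) + weight N M2)"
    proof -
      have "(u, d) \<notin> M2" "(s, c) \<notin> insert (u, d) M2"
        using cd(3,4) uM(2) by (auto intro: rev_image_eqI)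
      then show ?thesis using fM2 by (simp add: weight_insert)
    qed
    moreover have "weight N M1 = (N - u) * (N - c) + weight N M2"
      using weight_insert[of M2 u c N] fM2 u by (simp add: M2_def insert_absorb)
    moreover have "(N - s) * (N - d) + (N - u) * (N - c) < (N - s) * (N - c) + (N - u) * (N - d)"
      using \<open>s < u\<close> \<open>c < d\<close> lt \<open>u < N\<close> by (intro rearrangement_aux) auto
    ultimately show ?thesis
      using wM by (intro bexI[of _ "insert (s, c) (insert (u, d) M2)"]) auto
  qed
qed

text \<open>There are finitely many matchings, so one has maximal weight. By the exchange step it
  can only be \<open>K\<close>, and every other matching is strictly beaten.\<close>

lemma row_matching_weight_less:
  assumes K: "sw_chain K" and fin: "finite K" "finite T'"
    and T': "\<And>p c. p \<in> K \<Longrightarrow> c \<in> T' \<Longrightarrow> snd p < c"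
    and N: "\<And>i. i \<in> fst ` K \<union> snd ` K \<union> T' \<Longrightarrow> i < N"
    and M: "M \<in> row_matchings (fst ` K) (snd ` K \<union> T')" "M \<noteq> K"
  shows "weight N M < weight N K"
proof -
  let ?RM = "row_matchings (fst ` K) (snd ` K \<union> T')"
  have "finite ?RM" using fin by (intro finite_row_matchings) auto
  moreover have "?RM \<noteq> {}" using M by auto
  ultimately have "Max (weight N ` ?RM) \<in> weight N ` ?RM"
      "\<And>M. M \<in> ?RM \<Longrightarrow> weight N M \<le> Max (weight N ` ?RM)"
    by auto
  then obtain L where L: "L \<in> ?RM" "\<And>M. M \<in> ?RM \<Longrightarrow> weight N M \<le> weight N L"
    by auto
  have "L = K"
    using row_matching_improve[OF K fin T' N L(1)] L(2) by (meson linorder_not_less)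
  then show ?thesis
    using row_matching_improve[OF K fin T' N M] L(2) by (meson order_less_le_trans)
qed

section \<open>Rewriting a placement with a deficient chain\<close>

text \<open>The sum over injections of the rows of \<open>K\<close> into the columns of
  \<open>K\<close> and the missing columns beyond \<open>b\<close> lies in \<open>V\<close> and
  contains \<open>Y B\<close> as the term for \<open>K\<close>. All other terms have smaller weight
  and are covered by \<open>IH\<close>.\<close>

lemma (in add_subgroup) straighten_rows:
  assumes fin: "finite R" "finite C"
    and rel: "\<And>B i. B \<subseteq> R \<times> C \<Longrightarrow> rook B \<Longrightarrow> i \<in> R - fst ` B \<Longrightarrow>
      (\<Sum>j\<in>C - snd ` B. Y (insert (i, j) B)) \<in> V"
    and N: "\<And>i. i \<in> R \<union> C \<Longrightarrow> i < N"
    and B: "B \<subseteq> R \<times> C" "rook B"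
    and IH: "\<And>B'. B' \<subseteq> R \<times> C \<Longrightarrow> rook B' \<Longrightarrow> weight N B' < weight N B \<Longrightarrow> Y B' \<in> V"
    and K: "sw_chain K" "K \<subseteq> B"
    and top: "b \<in> K" "\<And>p. p \<in> K \<Longrightarrow> snd p \<le> snd b"
    and few: "card {c \<in> C - snd ` B. c < snd b} < card K"
  shows "Y B \<in> V"
proof -
  define D where "D = B - K"
  define T' where "T' = {c \<in> C - snd ` B. snd b < c}"
  let ?S = "fst ` K" and ?T = "snd ` K \<union> T'"
  have finB: "finite B" using B(1) fin by (meson finite_SigmaI finite_subset)
  have finK: "finite K" using K(2) finB finite_subset by blast
  have rK: "rook K" and rD: "rook D" using B(2) K(2) rook_subset by (auto simp: D_def)
  have disj: "fst ` D \<inter> fst ` K = {}" "snd ` D \<inter> snd ` K = {}"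
    using B(2) K(2) unfolding D_def rook_def inj_on_def by blast+
  have BDK: "B = D \<union> K" using K(2) by (auto simp: D_def)
  have bB: "snd b \<in> snd ` B" using top K by auto
  define L where "L = {c \<in> C - snd ` B. c < snd b}"
  have "C - snd ` B = L \<union> T'"
    using bB by (auto simp: T'_def L_def) (metis linorder_neqE_nat image_eqI snd_conv)
  moreover have "card (L \<union> T') = card L + card T'"
    using fin by (intro card_Un_disjoint) (auto simp: T'_def L_def)
  ultimately have "card (C - snd ` B) = card L + card T'"
    by simp
  moreover have "card (C - snd ` B) = card C - card B"
    using card_Diff_subset[of "snd ` B" C] finB B card_snd_rook[OF B(2)] by force
  moreover have "card B \<le> card C"
    using card_mono[OF fin(2), of "snd ` B"] B card_snd_rook[OF B(2)] by force
  moreover have "card ?T = card K + card T'"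
    using card_snd_rook[OF rK] K(2) fin finK by (subst card_Un_disjoint) (auto simp: T'_def)
  moreover have "card B = card D + card K"
    unfolding BDK using finB finK by (subst card_Un_disjoint) (auto simp: D_def)
  \<comment> \<open>With \<open>L\<close> and \<open>T'\<close> the missing columns before and after
    \<open>b\<close>, the right-hand side is \<open>card K + card T' + card B\<close>, while
    \<open>card C = card L + card T' + card B\<close>. The bound therefore says
    \<open>card L < card K\<close>.\<close>
  ultimately have card: "card C < card ?S + card ?T + card D"
    using few card_fst_rook[OF rK] by (simp add: L_def)
  have KRC: "fst ` K \<subseteq> R" "snd ` K \<subseteq> C"
    using B(1) K(2) by auto
  have SD: "?S \<subseteq> R - fst ` D" using disj(1) KRC(1) by blast
  have "T' \<subseteq> C - snd ` D" by (auto simp: T'_def D_def)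
  then have TD: "?T \<subseteq> C - snd ` D" using disj(2) KRC(2) by blast
  have "(\<Sum>M\<in>row_matchings ?S ?T. Y (D \<union> M)) \<in> V"
    using B(1) by (intro row_matchings_sum_mem[OF fin rel _ rD SD TD card]) (auto simp: D_def)
  moreover have KM: "K \<in> row_matchings ?S ?T"
    using rK by (auto simp: row_matchings_def) (force+)
  moreover have finM: "finite (row_matchings ?S ?T)"
    using finK fin by (intro finite_row_matchings) (auto simp: T'_def)
  ultimately have *: "Y B + (\<Sum>M\<in>row_matchings ?S ?T - {K}. Y (D \<union> M)) \<in> V"
    using sum.remove[OF finM KM, of "\<lambda>M. Y (D \<union> M)"] BDK by simp
  have "Y (D \<union> M) \<in> V" if M: "M \<in> row_matchings ?S ?T - {K}" for M
  proof -
    have M': "M \<subseteq> ?S \<times> ?T" "rook M" using M by (auto simp: row_matchings_def)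
    have MC: "M \<subseteq> (R - fst ` D) \<times> (C - snd ` D)" using M' SD TD by blast
    have "finite M" using finite_subset[OF MC] fin by blast
    have "weight N M < weight N K"
    proof (rule row_matching_weight_less[of K T'])
      show "\<And>p c. p \<in> K \<Longrightarrow> c \<in> T' \<Longrightarrow> snd p < c" using top by (force simp: T'_def)
      show "\<And>i. i \<in> fst ` K \<union> snd ` K \<union> T' \<Longrightarrow> i < N" using N SD TD by blast
    qed (use K M finK fin in \<open>auto simp: T'_def\<close>)
    moreover have "weight N (D \<union> M) = weight N D + weight N M"
      using finB \<open>finite M\<close> MC by (intro weight_Un) (force simp: D_def)+
    moreover have "weight N B = weight N D + weight N K"
      unfolding BDK using finB finK by (intro weight_Un) (auto simp: D_def)
    moreover have "rook (D \<union> M)" using MC by (intro rook_Un rD M'(2)) force+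
    moreover have "D \<union> M \<subseteq> R \<times> C" using B(1) MC by (auto simp: D_def)
    ultimately show ?thesis by (intro IH) auto
  qed
  then have "(\<Sum>M\<in>row_matchings ?S ?T - {K}. Y (D \<union> M)) \<in> V" by (rule sum_mem)
  from diff_mem[OF * this] show ?thesis by simp
qed

subsection \<open>Shadow lines and their inverse\<close>

text \<open>\<open>corners\<close> ranges over all lists enumerating a layer by increasing rows;
  uniqueness lets it be computed from any one of them.\<close>

lemma sorted_wrt_fst_unique:
  assumes "sorted_wrt (\<lambda>p q. fst p < fst q) ps" "sorted_wrt (\<lambda>p q. fst p < fst q) qs"
    and "set ps = set qs"
  shows "(ps :: (nat \<times> nat) list) = qs"
proof -
  have *: "sorted (map fst xs) \<and> distinct (map fst xs)"
    if "sorted_wrt (\<lambda>p q. fst p < fst q) xs" for xs :: "(nat \<times> nat) list"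
    using that strict_sorted_iff[of "map fst xs"] by (simp add: sorted_wrt_map)
  show ?thesis
    using *[OF assms(1)] *[OF assms(2)] assms(3)
    by (intro map_sorted_distinct_set_unique[of fst]) (auto simp: distinct_map)
qed

lemma ex_sorted_wrt_fst:
  assumes "finite P" "inj_on fst P"
  shows "\<exists>ps. set ps = P \<and> sorted_wrt (\<lambda>p q. fst p < (fst q :: nat)) ps"
proof -
  obtain xs where xs: "set xs = P" "distinct xs"
    using finite_distinct_list[OF assms(1)] by blast
  have "distinct (map fst (sort_key fst xs))"
    using xs assms(2) by (simp add: distinct_map)
  then have "sorted_wrt (<) (map fst (sort_key fst xs))"
    by (simp add: strict_sorted_iff)
  then show ?thesis
    using xs(1) by (intro exI[of _ "sort_key fst xs"]) (simp add: sorted_wrt_map)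
qed

lemma corners_set:
  assumes "sorted_wrt (\<lambda>p q. fst p < fst q) ps"
  shows "corners (set ps) = {(fst (ps ! Suc t), snd (ps ! t)) | t. Suc t < length ps}"
  using sorted_wrt_fst_unique[OF _ assms] assms unfolding corners_def by blast

lemma corners_empty: "corners {} = {}"
  using corners_set[of "[]"] by simp

text \<open>The inverse of taking corners: \<open>ps\<close> lists the corners, and \<open>r\<close>, \<open>c\<close> are the row and the
  column of the two unbounded rays of the shadow line.\<close>

definition shadow_line :: "nat \<Rightarrow> nat \<Rightarrow> (nat \<times> nat) list \<Rightarrow> (nat \<times> nat) list" where
  "shadow_line r c ps = zip (r # map fst ps) (map snd ps @ [c])"

text \<open>This is the condition for the points of \<open>shadow_line r c ps\<close> to have
  increasing rows and decreasing columns.\<close>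

definition line_corners :: "nat \<Rightarrow> nat \<Rightarrow> (nat \<times> nat) list \<Rightarrow> bool" where
  "line_corners r c ps \<longleftrightarrow> sorted_wrt (<) (r # map fst ps) \<and> sorted_wrt (>) (map snd ps @ [c])"

lemma length_shadow_line [simp]: "length (shadow_line r c ps) = Suc (length ps)"
  by (simp add: shadow_line_def)

lemma map_fst_shadow_line: "map fst (shadow_line r c ps) = r # map fst ps"
  and map_snd_shadow_line: "map snd (shadow_line r c ps) = map snd ps @ [c]"
  by (simp_all add: shadow_line_def)

lemma fst_shadow_line: "fst ` set (shadow_line r c ps) = insert r (fst ` set ps)"
  and snd_shadow_line: "snd ` set (shadow_line r c ps) = insert c (snd ` set ps)"
  using arg_cong[OF map_fst_shadow_line[of r c ps], of set]
    arg_cong[OF map_snd_shadow_line[of r c ps], of set] by simp_all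

lemma fst_nth_shadow_line: "t \<le> length ps \<Longrightarrow> fst (shadow_line r c ps ! t) = (r # map fst ps) ! t"
  and snd_nth_shadow_line: "t \<le> length ps \<Longrightarrow> snd (shadow_line r c ps ! t) = (map snd ps @ [c]) ! t"
  by (simp_all add: shadow_line_def)

lemma shadow_line_fst_mono:
  assumes "line_corners r c ps" "a < b" "b \<le> length ps"
  shows "fst (shadow_line r c ps ! a) < fst (shadow_line r c ps ! b)"
  using assms sorted_wrt_nth_less[of "(<)" "r # map fst ps" a b]
  by (simp add: line_corners_def fst_nth_shadow_line)

lemma shadow_line_snd_antimono:
  assumes "line_corners r c ps" "a < b" "b \<le> length ps"
  shows "snd (shadow_line r c ps ! b) < snd (shadow_line r c ps ! a)"
  using assms sorted_wrt_nth_less[of "(>)" "map snd ps @ [c]" a b]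
  by (simp add: line_corners_def snd_nth_shadow_line)

text \<open>By the shift built into \<open>zip\<close>, corner \<open>t\<close> has its row from
  point \<open>Suc t\<close> of the line and its column from point \<open>t\<close>;
  \<open>corners\<close> combines exactly these two.\<close>

lemma corners_shadow_line:
  assumes "line_corners r c ps"
  shows "corners (set (shadow_line r c ps)) = set ps"
proof -
  have "sorted_wrt (\<lambda>p q. fst p < fst q) (shadow_line r c ps)"
    using shadow_line_fst_mono[OF assms] by (simp add: sorted_wrt_iff_nth_less)
  then have "corners (set (shadow_line r c ps)) =
    {(fst (shadow_line r c ps ! Suc t), snd (shadow_line r c ps ! t)) | t. t < length ps}"
    by (simp add: corners_set)
  moreover have nth: "(fst (shadow_line r c ps ! Suc t), snd (shadow_line r c ps ! t)) = ps ! t"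
    if "t < length ps" for t
    using that by (simp add: fst_nth_shadow_line snd_nth_shadow_line nth_append)
  ultimately have "corners (set (shadow_line r c ps)) = {ps ! t | t. t < length ps}"
    by (simp add: setcompr_eq_image nth cong: image_cong_simp)
  then show ?thesis by (simp add: set_conv_nth)
qed

lemma shadow_line_antichain:
  assumes "line_corners r c ps" "p \<in> set (shadow_line r c ps)" "q \<in> set (shadow_line r c ps)"
  shows "\<not> sw_of p q"
proof
  assume pq: "sw_of p q"
  obtain a b where ab: "p = shadow_line r c ps ! a" "a \<le> length ps"
      "q = shadow_line r c ps ! b" "b \<le> length ps"
    using assms(2,3) by (force simp: in_set_conv_nth less_Suc_eq_le)
  show False
    using shadow_line_fst_mono[OF assms(1), of b a] shadow_line_snd_antimono[OF assms(1), of a b]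
      pq ab unfolding sw_of_def by (metis less_asym linorder_neqE_nat)
qed

text \<open>Consecutive lines are nested. By \<open>max\<close>, a corner of the lower line that
  enters the quadrant of the upper rays lies south-west of an upper corner, so the upper line cannot
  pass beneath it.\<close>

lemma shadow_line_dominates:
  assumes ps: "line_corners r c ps" and qs: "line_corners r' c' qs"
    and rc: "r < r'" "c < c'"
    and max: "\<And>p. p \<in> set ps \<Longrightarrow> r' < fst p \<Longrightarrow> c' < snd p \<Longrightarrow> \<exists>q\<in>set qs. sw_of p q"
    and disj: "fst ` set ps \<inter> insert r' (fst ` set qs) = {}"
      "snd ` set ps \<inter> insert c' (snd ` set qs) = {}"
    and y: "y \<in> set (shadow_line r' c' qs)"
  shows "\<exists>x\<in>set (shadow_line r c ps). sw_of x y"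
proof -
  obtain a where a: "y = shadow_line r' c' qs ! a" "a \<le> length qs"
    using y by (force simp: in_set_conv_nth less_Suc_eq_le)
  have yin: "fst y \<in> insert r' (fst ` set qs)" "snd y \<in> insert c' (snd ` set qs)"
    using imageI[OF y, of fst] imageI[OF y, of snd]
    by (simp_all only: fst_shadow_line snd_shadow_line)
  have ry: "r' \<le> fst y"
    using yin(1) qs by (auto simp: line_corners_def)
  have cy: "c' \<le> snd y"
    using yin(2) qs by (auto simp: line_corners_def sorted_wrt_append)
  \<comment> \<open>The witness is point \<open>b\<close>, the last one of the lower line in a row
    before that of \<open>y\<close>.\<close>
  define G where "G = {b. b \<le> length ps \<and> fst (shadow_line r c ps ! b) < fst y}"
  have G: "finite G" "0 \<in> G"
    using ry rc by (auto simp: G_def fst_nth_shadow_line)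
  define b where "b = Max G"
  have "b \<in> G" unfolding b_def using G by (intro Max_in) auto
  then have b: "b \<le> length ps" "fst (shadow_line r c ps ! b) < fst y"
    by (auto simp: G_def)
  have "snd (shadow_line r c ps ! b) < snd y"
  proof (cases "b = length ps")
    case True
    then show ?thesis using cy rc by (simp add: snd_nth_shadow_line nth_append)
  next
    case False
    with b have bl: "b < length ps" by simp
    have "Suc b \<notin> G" using Max_ge[OF G(1), of "Suc b"] by (auto simp: b_def)
    then have "fst y \<le> fst (ps ! b)" using bl by (auto simp: G_def fst_nth_shadow_line)
    moreover have "fst (ps ! b) \<noteq> fst y" "snd (ps ! b) \<noteq> snd y"
      using disj yin bl nth_mem[OF bl] by (metis disjoint_iff imageI)+
    ultimately have fy: "fst y < fst (ps ! b)" by simp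
    \<comment> \<open>Otherwise \<open>max\<close> gives a corner \<open>qs ! d\<close> beyond
      \<open>ps ! b\<close> and hence beyond \<open>y\<close>. It sits between the points
      \<open>d\<close> and \<open>Suc d\<close> of the upper line, which forces both
      \<open>a < Suc d\<close> and \<open>d < a\<close> for the index \<open>a\<close> of
      \<open>y\<close>.\<close>
    have "\<not> snd y < snd (ps ! b)"
    proof
      assume sy: "snd y < snd (ps ! b)"
      obtain q where "q \<in> set qs" "sw_of (ps ! b) q"
        using max[OF nth_mem[OF bl]] fy sy ry cy by force
      then obtain d where d: "d < length qs" "sw_of (ps ! b) (qs ! d)"
        by (auto simp: in_set_conv_nth)
      have "fst (shadow_line r' c' qs ! a) < fst (shadow_line r' c' qs ! Suc d)"
        using d fy a by (auto simp: fst_nth_shadow_line sw_of_def)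
      then have "a < Suc d"
        using shadow_line_fst_mono[OF qs, of "Suc d" a] a by (metis less_asym linorder_neqE_nat)
      moreover have "snd (shadow_line r' c' qs ! a) < snd (shadow_line r' c' qs ! d)"
        using d sy a by (auto simp: snd_nth_shadow_line sw_of_def nth_append)
      then have "d < a"
        using shadow_line_snd_antimono[OF qs, of a d] d by (metis less_asym less_imp_le linorder_neqE_nat)
      ultimately show False by simp
    qed
    then show ?thesis
      using bl \<open>snd (ps ! b) \<noteq> snd y\<close> by (simp add: snd_nth_shadow_line nth_append)
  qed
  then show ?thesis
    using b nth_mem[of b "shadow_line r c ps"] by (auto simp: sw_of_def less_Suc_eq_le)
qed

section \<open>Maximal points and successive layers\<close>

definition sw_maximal :: "(nat \<times> nat) set \<Rightarrow> (nat \<times> nat) set" where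
  "sw_maximal P = {x \<in> P. \<not> (\<exists>y\<in>P. sw_of x y)}"

text \<open>Among the points of \<open>P\<close> beyond \<open>x\<close>, one with the largest row
  is maximal.\<close>

lemma sw_maximal_above:
  assumes "finite P" "x \<in> P" "x \<notin> sw_maximal P"
  shows "\<exists>y\<in>sw_maximal P. sw_of x y"
proof -
  let ?A = "{y \<in> P. sw_of x y}"
  have A: "finite ?A" "?A \<noteq> {}" using assms by (auto simp: sw_maximal_def)
  then have "Max (fst ` ?A) \<in> fst ` ?A" by (intro Max_in) auto
  then obtain y where y: "y \<in> ?A" "fst y = Max (fst ` ?A)" by auto
  have "y \<in> sw_maximal P"
  proof (rule ccontr)
    assume "y \<notin> sw_maximal P"
    then obtain z where z: "z \<in> P" "sw_of y z" using y by (auto simp: sw_maximal_def)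
    then have "z \<in> ?A" using y by (auto simp: sw_of_def)
    then have "fst z \<le> fst y" using A(1) unfolding y(2) by (intro Max_ge) auto
    then show False using z by (simp add: sw_of_def)
  qed
  then show ?thesis using y by auto
qed

text \<open>Otherwise all elements below \<open>t\<close> would occur among the first
  \<open>m\<close> positions, and there are more than \<open>m\<close> of them.\<close>

lemma sorted_list_of_set_nth_less:
  fixes t :: nat
  assumes "finite A" "m < card {x \<in> A. x < t}"
  shows "sorted_list_of_set A ! m < t"
proof (rule ccontr)
  let ?l = "sorted_list_of_set A"
  assume n: "\<not> ?l ! m < t"
  have "{x \<in> A. x < t} \<subseteq> (!) ?l ` {..<m}"
  proof
    fix x assume x: "x \<in> {x \<in> A. x < t}"
    then obtain i where i: "i < length ?l" "x = ?l ! i"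
      using assms(1) by (metis (mono_tags, lifting) in_set_conv_nth mem_Collect_eq set_sorted_list_of_set)
    have "i < m"
    proof (rule ccontr)
      assume "\<not> i < m"
      then have "?l ! m \<le> ?l ! i" using i by (intro sorted_nth_mono) auto
      then show False using x i n by simp
    qed
    then show "x \<in> (!) ?l ` {..<m}" using i by auto
  qed
  from surj_card_le[OF _ this] show False using assms(2) by simp
qed

text \<open>Each \<open>W k\<close> is an antichain and every point of \<open>W (Suc k)\<close> lies
  beyond a point of \<open>W k\<close>, so peeling off first layers returns the \<open>W k\<close>
  in order.\<close>

lemma layers_shadow_set:
  fixes W :: "nat \<Rightarrow> (nat \<times> nat) set"
  assumes antichain: "\<And>k x y. k < p \<Longrightarrow> x \<in> W k \<Longrightarrow> y \<in> W k \<Longrightarrow> \<not> sw_of x y"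
    and dom: "\<And>k y. Suc k < p \<Longrightarrow> y \<in> W (Suc k) \<Longrightarrow> \<exists>x\<in>W k. sw_of x y"
  shows "shadow_set (\<Union>k<p. W k) = (\<Union>k<p. corners (W k))"
proof -
  \<comment> \<open>\<open>U m\<close> is what remains after \<open>m\<close> rounds.\<close>
  define U where "U = (\<lambda>m. \<Union>k\<in>{m..<p}. W k)"
  have trans: "sw_of x y \<Longrightarrow> sw_of y z \<Longrightarrow> sw_of x z" for x y z
    by (auto simp: sw_of_def)
  have below: "\<exists>y\<in>W m. y = z \<or> sw_of y z" if "m \<le> l" "l < p" "z \<in> W l" for m l z
    using that
  proof (induction l arbitrary: z)
    case 0
    then show ?case by auto
  next
    case (Suc l)
    show ?case
    proof (cases "m = Suc l")
      case True
      then show ?thesis using Suc.prems by auto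
    next
      case False
      obtain x where x: "x \<in> W l" "sw_of x z" using dom Suc.prems by blast
      have "\<exists>y\<in>W m. y = x \<or> sw_of y x" using Suc.prems False x by (intro Suc.IH) auto
      then show ?thesis using x trans by blast
    qed
  qed
  have first: "first_layer (U m) = W m" if m: "m < p" for m
  proof
    show "first_layer (U m) \<subseteq> W m"
    proof
      fix x assume x: "x \<in> first_layer (U m)"
      then obtain l where l: "m \<le> l" "l < p" "x \<in> W l"
        by (auto simp: first_layer_def U_def)
      show "x \<in> W m"
      proof (rule ccontr)
        assume "x \<notin> W m"
        with l obtain l' where l': "l = Suc l'" "m < Suc l'" by (cases l) (auto simp: le_less)
        then obtain y where "y \<in> W l'" "sw_of y x" using dom[of l' x] l by auto
        moreover have "y \<in> U m" using l' l \<open>y \<in> W l'\<close> by (auto simp: U_def)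
        ultimately show False using x by (force simp: first_layer_def sw_of_def)
      qed
    qed
    show "W m \<subseteq> first_layer (U m)"
    proof
      fix x assume x: "x \<in> W m"
      have "\<not> sw_of z x" if z: "z \<in> U m" for z
      proof
        assume zx: "sw_of z x"
        obtain l where "m \<le> l" "l < p" "z \<in> W l" using z by (auto simp: U_def)
        then obtain y where "y \<in> W m" "y = z \<or> sw_of y z" using below by blast
        then show False using antichain[OF m _ x] zx trans by blast
      qed
      moreover have "x \<in> U m" using x m by (auto simp: U_def)
      ultimately show "x \<in> first_layer (U m)"
        by (force simp: first_layer_def sw_of_def split: prod.splits)
    qed
  qed
  have remove: "remove_layer (U m) = U (Suc m)" for m
  proof (cases "m < p")
    case True
    have "W m \<inter> W l = {}" if l: "Suc m \<le> l" "l < p" for l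
    proof (rule ccontr)
      assume "W m \<inter> W l \<noteq> {}"
      then obtain z where z: "z \<in> W m" "z \<in> W l" by auto
      obtain l' where l': "l = Suc l'" using l by (cases l) auto
      then obtain x where x: "x \<in> W l'" "sw_of x z" using dom z l by blast
      obtain y where "y \<in> W m" "y = x \<or> sw_of y x" using below[of m l' x] x l' l by auto
      then show False using antichain[OF True _ z(1)] x trans by blast
    qed
    moreover have "{m..<p} = insert m {Suc m..<p}" using True by auto
    then have "U m = W m \<union> U (Suc m)" by (simp add: U_def)
    ultimately show ?thesis
      unfolding remove_layer_def first[OF True] by (force simp: U_def)
  next
    case False
    then show ?thesis by (auto simp: U_def remove_layer_def)
  qed
  have "(remove_layer ^^ m) (U 0) = U m" for m
    by (induction m) (simp_all add: remove)
  then have "shadow_set (U 0) = (\<Union>m. corners (first_layer (U m)))"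
    by (simp add: shadow_set_def)
  also have "\<dots> = (\<Union>m<p. corners (W m))"
  proof -
    \<comment> \<open>From round \<open>p\<close> on nothing is left, and no corners appear.\<close>
    have "corners (first_layer (U m)) = (if m < p then corners (W m) else {})" for m
      by (auto simp: first) (auto simp: U_def first_layer_def corners_empty)
    then show ?thesis by (auto split: if_splits)
  qed
  finally show ?thesis by (simp add: U_def atLeast0LessThan)
qed

text \<open>The shadow lines are recovered from the outside inwards: the corners of the outermost
  remaining line are the maximal remaining points in the quadrant cut out by its two rays.\<close>

lemma ex_shadow_preimage:
  assumes fin: "finite R" "finite C" and card: "card R = card C"
    and B: "B \<subseteq> R \<times> C" "rook B"
    and rows: "\<And>K b. K \<subseteq> B \<Longrightarrow> sw_chain K \<Longrightarrow> b \<in> K \<Longrightarrow> (\<And>x. x \<in> K \<Longrightarrow> fst x \<le> fst b) \<Longrightarrow>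
      card K \<le> card {r \<in> R - fst ` B. r < fst b}"
    and cols: "\<And>K b. K \<subseteq> B \<Longrightarrow> sw_chain K \<Longrightarrow> b \<in> K \<Longrightarrow> (\<And>x. x \<in> K \<Longrightarrow> snd x \<le> snd b) \<Longrightarrow>
      card K \<le> card {c \<in> C - snd ` B. c < snd b}"
  shows "\<exists>W. W \<subseteq> R \<times> C \<and> rook W \<and> fst ` W = R \<and> snd ` W = C \<and> shadow_set W = B"
proof -
  have finB: "finite B" using finite_subset[OF B(1)] fin by blast
  \<comment> \<open>\<open>rs\<close> and \<open>cs\<close> list the missing rows and columns, which
    become the rays; \<open>p\<close> is the number of shadow lines.\<close>
  define rs where "rs = sorted_list_of_set (R - fst ` B)"
  define cs where "cs = sorted_list_of_set (C - snd ` B)"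
  define p where "p = card R - card B"
  have imB: "fst ` B \<subseteq> R" "snd ` B \<subseteq> C" using B(1) by auto
  have cardR: "card R = p + card B"
    using card_mono[OF fin(1) imB(1)] card_fst_rook[OF B(2)] by (simp add: p_def)
  have lrs: "length rs = p" and lcs: "length cs = p"
    using imB fin finB card card_fst_rook[OF B(2)] card_snd_rook[OF B(2)]
    by (simp_all add: rs_def cs_def p_def card_Diff_subset)
  have set_rs: "set rs = R - fst ` B" and set_cs: "set cs = C - snd ` B"
    using fin by (simp_all add: rs_def cs_def)
  have inc: "rs ! k < rs ! Suc k" "cs ! k < cs ! Suc k" if "Suc k < p" for k
    using that lrs lcs sorted_wrt_nth_less[of "(<)" rs k "Suc k"] sorted_wrt_nth_less[of "(<)" cs k "Suc k"]
    by (simp_all add: rs_def cs_def)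
  have rsB: "rs ! k \<notin> fst ` B" "cs ! k \<notin> snd ` B" if "k < p" for k
    using that lrs lcs set_rs set_cs nth_mem[of k rs] nth_mem[of k cs] by auto
  define Q where "Q = (\<lambda>k. {x. rs ! k < fst x \<and> cs ! k < snd x})"
  \<comment> \<open>Line \<open>p - 1\<close> is formed first, so \<open>E\<close> counts rounds
    while \<open>D\<close> is indexed by lines: \<open>D k\<close> are the points left once lines
    \<open>k\<close> to \<open>p - 1\<close> have taken theirs, and \<open>T k\<close> are the
    corners of line \<open>k\<close>.\<close>
  define E where "E = rec_nat B (\<lambda>m X. X - sw_maximal (X \<inter> Q (p - Suc m)))"
  define D where "D = (\<lambda>k. E (p - k))"
  define T where "T = (\<lambda>k. sw_maximal (D (Suc k) \<inter> Q k))"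
  have Dp: "D p = B" by (simp add: D_def E_def)
  have D_step: "D k = D (Suc k) - T k" if "k < p" for k
  proof -
    have "p - k = Suc (p - Suc k)" "p - Suc (p - Suc k) = k" using that by auto
    then show ?thesis by (simp add: D_def E_def T_def)
  qed
  have T_sub: "T k \<subseteq> D (Suc k)" "T k \<subseteq> Q k" for k
    by (auto simp: T_def sw_maximal_def)
  have D_mono: "D k \<subseteq> D l" if "k \<le> l" "l \<le> p" for k l
    using that by (induction l) (auto simp: le_Suc_eq D_step)
  have DB: "D k \<subseteq> B" if "k \<le> p" for k
    using D_mono[OF that] Dp by simp
  have TB: "T k \<subseteq> B" if "k < p" for k
    using T_sub(1)[of k] DB[of "Suc k"] that by auto
  \<comment> \<open>A leftover point would grow, one line at a time, into a chain of
    \<open>p + 1\<close> points of \<open>B\<close>, although there are only \<open>p\<close>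
    missing rows. By \<open>rows\<close> and \<open>cols\<close>, the last point of a chain of
    \<open>m + 1\<close> points lies in \<open>Q m\<close>; if it is in \<open>D m\<close>, line
    \<open>m\<close> did not take it, so another point of \<open>D (Suc m)\<close> lies beyond
    it.\<close>
  have "D 0 = {}"
  proof (rule ccontr)
    assume "D 0 \<noteq> {}"
    then obtain x where x: "x \<in> D 0" by auto
    have "\<exists>K b. K \<subseteq> B \<and> sw_chain K \<and> card K = Suc m \<and> b \<in> K \<and> (\<forall>q\<in>K. q = b \<or> sw_of q b) \<and> b \<in> D m"
      if "m \<le> p" for m
      using that
    proof (induction m)
      case 0
      show ?case
        using x DB[of 0] by (intro exI[of _ "{x}"] exI[of _ x]) (auto simp: sw_chain_def)
    next
      case (Suc m)
      then obtain K b where K: "K \<subseteq> B" "sw_chain K" "card K = Suc m" "b \<in> K"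
          "\<And>q. q \<in> K \<Longrightarrow> q = b \<or> sw_of q b" "b \<in> D m"
        by (metis Suc_leD)
      have le: "fst q \<le> fst b" "snd q \<le> snd b" if "q \<in> K" for q
        using K(5)[OF that] by (auto simp: sw_of_def)
      \<comment> \<open>The chain has \<open>Suc m\<close> points, so at least that many missing
        rows and columns precede \<open>b\<close>; with positions counted from 0, entry
        \<open>m\<close> is among them.\<close>
      have "m < card {r \<in> R - fst ` B. r < fst b}" "m < card {c \<in> C - snd ` B. c < snd b}"
        using rows[OF K(1,2,4) le(1)] cols[OF K(1,2,4) le(2)] K(3) by auto
      then have "b \<in> Q m"
        using fin by (auto simp: Q_def rs_def cs_def intro: sorted_list_of_set_nth_less)
      moreover have "b \<in> D (Suc m)" "b \<notin> T m"
        using K(6) D_step[of m] Suc.prems by auto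
      ultimately obtain b' where b': "b' \<in> D (Suc m)" "sw_of b b'"
        by (auto simp: T_def sw_maximal_def)
      have tr: "sw_of q b'" if "q \<in> K" for q
        using K(5)[OF that] b'(2) by (auto simp: sw_of_def)
      then have "b' \<notin> K" using tr[of b'] by (auto simp: sw_of_def)
      moreover have "finite K" using K(1) finB finite_subset by blast
      ultimately have "card (insert b' K) = Suc (Suc m)" using K(3) by simp
      moreover have "sw_chain (insert b' K)" using K(2) tr by (auto simp: sw_chain_def)
      ultimately show ?case
        using b' K(1) DB[OF Suc.prems] tr
        by (intro exI[of _ "insert b' K"] exI[of _ b']) auto
    qed
    from this[of p] obtain K b where K: "K \<subseteq> B" "sw_chain K" "card K = Suc p" "b \<in> K"
        "\<And>q. q \<in> K \<Longrightarrow> q = b \<or> sw_of q b"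
      by blast
    have "fst q \<le> fst b" if "q \<in> K" for q
      using K(5)[OF that] by (auto simp: sw_of_def)
    then have "card K \<le> card {r \<in> R - fst ` B. r < fst b}"
      by (rule rows[OF K(1,2,4)])
    also have "\<dots> \<le> card (set rs)"
      unfolding set_rs using fin by (intro card_mono) auto
    also have "\<dots> \<le> p" using card_length[of rs] lrs by simp
    finally show False using K(3) by simp
  qed
  have D_UN: "D m = (\<Union>k<m. T k)" if "m \<le> p" for m
    using that
  proof (induction m)
    case 0
    then show ?case by (simp add: \<open>D 0 = {}\<close>)
  next
    case (Suc m)
    then have "D (Suc m) = D m \<union> T m" using D_step[of m] T_sub(1)[of m] by auto
    then show ?case using Suc by (auto simp: lessThan_Suc)
  qed
  then have B_UN: "B = (\<Union>k<p. T k)" using Dp by auto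
  have T_disj: "T k \<inter> T l = {}" if "k < l" "l < p" for k l
    using D_step[OF that(2)] T_sub(1)[of k] D_mono[of "Suc k" l] that by auto
  have finT: "finite (T k)" if "k < p" for k
    using TB[OF that] finB finite_subset by blast
  have "\<forall>k<p. \<exists>ps. set ps = T k \<and> line_corners (rs ! k) (cs ! k) ps"
  proof (intro allI impI)
    fix k assume k: "k < p"
    have rT: "rook (T k)" using rook_subset[OF B(2) TB[OF k]] .
    then obtain ps where ps: "set ps = T k" "sorted_wrt (\<lambda>x y. fst x < fst y) ps"
      using ex_sorted_wrt_fst[OF finT[OF k]] by (auto simp: rook_def)
    \<comment> \<open>Maximal points form an antichain, so within a rook placement increasing rows
      mean decreasing columns.\<close>
    have "snd y < snd x" if "x \<in> T k" "y \<in> T k" "fst x < fst y" for x y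
    proof -
      have "\<not> sw_of x y" using that by (auto simp: T_def sw_maximal_def)
      moreover have "snd x \<noteq> snd y" using rT that unfolding rook_def inj_on_def by blast
      ultimately show ?thesis using that by (simp add: sw_of_def)
    qed
    then have "sorted_wrt (\<lambda>x y. snd y < snd x) ps"
      using ps sorted_wrt_mono_rel[of ps "\<lambda>x y. fst x < fst y" "\<lambda>x y. snd y < snd x"] by blast
    then have "line_corners (rs ! k) (cs ! k) ps"
      using ps T_sub(2)[of k] by (auto simp: line_corners_def sorted_wrt_map sorted_wrt_append Q_def)
    then show "\<exists>ps. set ps = T k \<and> line_corners (rs ! k) (cs ! k) ps" using ps by blast
  qed
  then obtain ps where ps: "\<And>k. k < p \<Longrightarrow> set (ps k) = T k"
      "\<And>k. k < p \<Longrightarrow> line_corners (rs ! k) (cs ! k) (ps k)"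
    by metis
  define W where "W = (\<lambda>k. set (shadow_line (rs ! k) (cs ! k) (ps k)))"
  define U where "U = (\<Union>k<p. W k)"
  have dom: "\<exists>x\<in>W k. sw_of x y" if k: "Suc k < p" and y: "y \<in> W (Suc k)" for k y
  proof -
    have "k < p" using k by simp
    have disjT: "T k \<inter> T (Suc k) = {}" using T_disj k by blast
    have "fst ` T k \<inter> fst ` T (Suc k) = {}" "snd ` T k \<inter> snd ` T (Suc k) = {}"
      using B(2) TB[OF k] TB[OF \<open>k < p\<close>] disjT inj_on_image_Int[of fst B "T k" "T (Suc k)"]
        inj_on_image_Int[of snd B "T k" "T (Suc k)"] by (simp_all add: rook_def)
    moreover have "rs ! Suc k \<notin> fst ` T k" "cs ! Suc k \<notin> snd ` T k"
      using rsB[OF k] TB[OF \<open>k < p\<close>] by blast+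
    \<comment> \<open>A corner of line \<open>k\<close> was still present when line
      \<open>Suc k\<close> was formed and was not taken by it, so in the quadrant of that line it is
      not maximal.\<close>
    moreover have "\<exists>q\<in>T (Suc k). sw_of x q"
      if x: "x \<in> T k" "rs ! Suc k < fst x" "cs ! Suc k < snd x" for x
    proof -
      have "x \<in> D (Suc k)" using x T_sub by blast
      then have "x \<in> D (Suc (Suc k)) \<inter> Q (Suc k)" "x \<notin> T (Suc k)"
        using D_step[OF k] x by (auto simp: Q_def)
      moreover have "finite (D (Suc (Suc k)) \<inter> Q (Suc k))"
        using DB[of "Suc (Suc k)"] k finB by (auto intro: finite_subset)
      ultimately show ?thesis using sw_maximal_above unfolding T_def by blast
    qed
    ultimately show ?thesis
      using shadow_line_dominates[OF ps(2)[OF \<open>k < p\<close>] ps(2)[OF k] inc[OF k], of y]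
        y ps(1)[OF k] ps(1)[OF \<open>k < p\<close>] unfolding W_def by simp
  qed
  have "shadow_set U = (\<Union>k<p. corners (W k))"
    unfolding U_def
  proof (rule layers_shadow_set[OF _ dom])
    show "\<not> sw_of x y" if "k < p" "x \<in> W k" "y \<in> W k" for k x y
      using shadow_line_antichain[OF ps(2)[OF that(1)]] that by (simp add: W_def)
  qed
  also have "\<dots> = B"
    unfolding B_UN using corners_shadow_line[OF ps(2)] ps(1) by (simp add: W_def)
  finally have shadow: "shadow_set U = B" .
  have set_nth: "set xs = (\<Union>k<p. {xs ! k})" if "length xs = p" for xs :: "nat list"
    using that by (auto simp: set_conv_nth)
  have "fst ` U = (\<Union>k<p. insert (rs ! k) (fst ` T k))"
    using ps(1) by (simp add: U_def W_def image_UN fst_shadow_line)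
  also have "\<dots> = set rs \<union> fst ` B"
    unfolding set_nth[OF lrs] by (subst B_UN) blast
  finally have fstU: "fst ` U = R" using set_rs imB by auto
  have "snd ` U = (\<Union>k<p. insert (cs ! k) (snd ` T k))"
    using ps(1) by (simp add: U_def W_def image_UN snd_shadow_line)
  also have "\<dots> = set cs \<union> snd ` B"
    unfolding set_nth[OF lcs] by (subst B_UN) blast
  finally have sndU: "snd ` U = C" using set_cs imB by auto
  have finU: "finite U" by (simp add: U_def W_def)
  \<comment> \<open>\<open>U\<close> has at most \<open>p + card B = card R\<close> points but
    projects onto all of \<open>R\<close> and all of \<open>C\<close>; hence both projections are
    injective.\<close>
  have "card U \<le> (\<Sum>k<p. card (W k))"
    unfolding U_def by (rule card_UN_le) simp
  also have "\<dots> \<le> (\<Sum>k<p. Suc (card (T k)))"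
  proof (rule sum_mono)
    fix k assume "k \<in> {..<p}"
    then have k: "k < p" by simp
    have "distinct (ps k)"
      using ps(2)[OF k] by (auto simp: line_corners_def strict_sorted_iff distinct_map)
    then have "length (ps k) = card (T k)" using ps(1)[OF k] distinct_card by metis
    then show "card (W k) \<le> Suc (card (T k))"
      using card_length[of "shadow_line (rs ! k) (cs ! k) (ps k)"] by (simp add: W_def)
  qed
  also have "\<dots> = p + (\<Sum>k<p. card (T k))" by (simp add: sum_Suc)
  also have "(\<Sum>k<p. card (T k)) = card B"
    unfolding B_UN using finT T_disj
    by (subst card_UN_disjoint) (auto, metis disjoint_iff linorder_neqE_nat)
  finally have "card U \<le> card R" using cardR by simp
  then have "card (fst ` U) = card U" "card (snd ` U) = card U"
    using card_image_le[OF finU, of fst] card_image_le[OF finU, of snd] fstU sndU card by auto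
  then have "rook U" unfolding rook_def using finU eq_card_imp_inj_on by blast
  moreover have "U \<subseteq> R \<times> C" using fstU sndU by force
  ultimately show ?thesis using fstU sndU shadow by blast
qed

subsection \<open>Spanning for rook placements\<close>

lemma sw_chain_swap: "sw_chain (prod.swap ` K) \<longleftrightarrow> sw_chain K"
proof -
  have "sw_of (prod.swap p) (prod.swap q) \<longleftrightarrow> sw_of p q" for p q
    by (auto simp: sw_of_def)
  then show ?thesis by (simp add: sw_chain_def inj_eq[OF inj_swap])
qed

text \<open>Reflection in the diagonal interchanges rows and columns and preserves weights and
  chains, so the row version applies to the reflected placement.\<close>

lemma (in add_subgroup) straighten_cols:
  assumes fin: "finite R" "finite C"
    and rel: "\<And>B j. B \<subseteq> R \<times> C \<Longrightarrow> rook B \<Longrightarrow> j \<in> C - snd ` B \<Longrightarrow>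
      (\<Sum>i\<in>R - fst ` B. Y (insert (i, j) B)) \<in> V"
    and N: "\<And>i. i \<in> R \<union> C \<Longrightarrow> i < N"
    and B: "B \<subseteq> R \<times> C" "rook B"
    and IH: "\<And>B'. B' \<subseteq> R \<times> C \<Longrightarrow> rook B' \<Longrightarrow> weight N B' < weight N B \<Longrightarrow> Y B' \<in> V"
    and K: "sw_chain K" "K \<subseteq> B"
    and top: "b \<in> K" "\<And>p. p \<in> K \<Longrightarrow> fst p \<le> fst b"
    and few: "card {r \<in> R - fst ` B. r < fst b} < card K"
  shows "Y B \<in> V"
proof -
  have im: "prod.swap ` prod.swap ` P = P" "fst ` prod.swap ` P = snd ` P" "snd ` prod.swap ` P = fst ` P"
    for P :: "(nat \<times> nat) set"
    by (simp_all add: image_image)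
  have swap_sub: "prod.swap ` P \<subseteq> A \<times> A'" if "P \<subseteq> A' \<times> A" for P and A A' :: "nat set"
    using that by auto
  have "Y (prod.swap ` prod.swap ` B) \<in> V"
  proof (rule straighten_rows[where R = C and C = R and N = N and K = "prod.swap ` K" and b = "prod.swap b"
        and Y = "\<lambda>P. Y (prod.swap ` P)"])
    show "(\<Sum>i\<in>R - snd ` P. Y (prod.swap ` insert (j, i) P)) \<in> V"
      if "P \<subseteq> C \<times> R" "rook P" "j \<in> C - fst ` P" for P j
      using rel[of "prod.swap ` P" j] that swap_sub[OF that(1)] by (simp add: im rook_swap)
    show "Y (prod.swap ` P) \<in> V"
      if "P \<subseteq> C \<times> R" "rook P" "weight N P < weight N (prod.swap ` B)" for P
      using that swap_sub[OF that(1)] by (intro IH) (simp_all add: rook_swap weight_swap)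
    show "card {c \<in> R - snd ` prod.swap ` B. c < snd (prod.swap b)} < card (prod.swap ` K)"
      using few by (simp add: im card_image)
    show "i < N" if "i \<in> C \<union> R" for i using N that by blast
    show "prod.swap ` K \<subseteq> prod.swap ` B" using K(2) by blast
    show "prod.swap b \<in> prod.swap ` K" using top(1) by blast
    show "snd p \<le> snd (prod.swap b)" if "p \<in> prod.swap ` K" for p using that top(2) by auto
  qed (use fin B K swap_sub[OF B(1)] in \<open>simp_all add: rook_swap sw_chain_swap\<close>)
  then show ?thesis by (simp add: im)
qed

text \<open>Induction on the weight. If some chain has too few missing rows or columns,
  straightening reduces to placements of smaller weight; if none has, \<open>B\<close> is the shadow
  set of a bijection and \<open>shadow\<close> applies.\<close>

lemma (in add_subgroup) rook_placement_mem:
  assumes fin: "finite R" "finite C" and card: "card R = card C"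
    and row_rel: "\<And>B i. B \<subseteq> R \<times> C \<Longrightarrow> rook B \<Longrightarrow> i \<in> R - fst ` B \<Longrightarrow>
      (\<Sum>j\<in>C - snd ` B. Y (insert (i, j) B)) \<in> V"
    and col_rel: "\<And>B j. B \<subseteq> R \<times> C \<Longrightarrow> rook B \<Longrightarrow> j \<in> C - snd ` B \<Longrightarrow>
      (\<Sum>i\<in>R - fst ` B. Y (insert (i, j) B)) \<in> V"
    and shadow: "\<And>W. W \<subseteq> R \<times> C \<Longrightarrow> rook W \<Longrightarrow> fst ` W = R \<Longrightarrow> snd ` W = C \<Longrightarrow> Y (shadow_set W) \<in> V"
    and B: "B \<subseteq> R \<times> C" "rook B"
  shows "Y B \<in> V"
proof -
  \<comment> \<open>\<open>insert 0\<close> keeps \<open>Max\<close> meaningful when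
    \<open>R\<close> and \<open>C\<close> are empty.\<close>
  define N where "N = Suc (Max (insert 0 (R \<union> C)))"
  have N: "i < N" if "i \<in> R \<union> C" for i
    unfolding N_def less_Suc_eq_le using that fin by (intro Max_ge) auto
  show ?thesis
    using B
  proof (induction "weight N B" arbitrary: B rule: less_induct)
    case less
    note B = less.prems
    have IH: "Y B' \<in> V" if "B' \<subseteq> R \<times> C" "rook B'" "weight N B' < weight N B" for B'
      using less.hyps that by blast
    show ?case
    proof (rule ccontr)
      assume n: "Y B \<notin> V"
      have "\<exists>W. W \<subseteq> R \<times> C \<and> rook W \<and> fst ` W = R \<and> snd ` W = C \<and> shadow_set W = B"
      proof (rule ex_shadow_preimage[OF fin card B])
        fix K b assume K: "K \<subseteq> B" "sw_chain K" "b \<in> K"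
        show "card K \<le> card {r \<in> R - fst ` B. r < fst b}" if "\<And>x. x \<in> K \<Longrightarrow> fst x \<le> fst b"
        proof (rule ccontr)
          assume few: "\<not> ?thesis"
          have "Y B \<in> V"
            by (rule straighten_cols[OF fin col_rel N B IH K(2,1,3) that few[unfolded not_le]])
          then show False using n by simp
        qed
        show "card K \<le> card {c \<in> C - snd ` B. c < snd b}" if "\<And>x. x \<in> K \<Longrightarrow> snd x \<le> snd b"
        proof (rule ccontr)
          assume few: "\<not> ?thesis"
          have "Y B \<in> V"
            by (rule straighten_rows[OF fin row_rel N B IH K(2,1,3) that few[unfolded not_le]])
          then show False using n by simp
        qed
      qed
      then show False using shadow n by blast
    qed
  qed
qed

subsection \<open>The quotient by the ideal\<close>

lemma poly_mapping_sum_single: "(\<Sum>k\<in>Poly_Mapping.keys p. Poly_Mapping.single k (Poly_Mapping.lookup p k)) = p"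
  by (rule poly_mapping_eqI) (simp add: lookup_sum lookup_single when_def in_keys_iff)

lemma single_sum_prod:
  "finite F \<Longrightarrow> Poly_Mapping.single (\<Sum>x\<in>F. f x) (1 :: complex) = (\<Prod>x\<in>F. Poly_Mapping.single (f x :: (nat \<times> nat) \<Rightarrow>\<^sub>0 nat) 1)"
proof (induction F rule: finite_induct)
  case (insert x F)
  then show ?case by (simp add: mult_single flip: insert.IH)
qed simp

lemma X_power: "X i j ^ m = Poly_Mapping.single (Poly_Mapping.single (i, j) m) 1"
proof (induction m)
  case (Suc m)
  have "X i j ^ Suc m = Poly_Mapping.single (Poly_Mapping.single (i, j) 1 + Poly_Mapping.single (i, j) m) 1"
    unfolding power_Suc Suc by (simp add: X_def mult_single)
  then show ?case by (simp add: single_add[symmetric])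
qed (simp add: single_one)

lemma monomial_eq_prod:
  "Poly_Mapping.single e 1 = (\<Prod>x\<in>Poly_Mapping.keys e. X (fst x) (snd x) ^ Poly_Mapping.lookup e x)"
  using single_sum_prod[of "Poly_Mapping.keys e" "\<lambda>x. Poly_Mapping.single x (Poly_Mapping.lookup e x)"]
  by (simp add: poly_mapping_sum_single X_power)

lemma monom_of_remove:
  "finite S \<Longrightarrow> (i, j) \<in> S \<Longrightarrow> monom_of S = X i j * monom_of (S - {(i, j)})"
  unfolding monom_of_def by (simp add: prod.remove)

lemma monom_of_insert:
  "finite S \<Longrightarrow> (i, j) \<notin> S \<Longrightarrow> monom_of (insert (i, j) S) = X i j * monom_of S"
  unfolding monom_of_def by simp

lemma monom_of_carrier:
  "S \<subseteq> {1..n} \<times> {1..n} \<Longrightarrow> monom_of S \<in> carrier (poly_ring n)"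
  unfolding monom_of_def by (auto intro!: prod_carrier X_carrier)

section \<open>Membership in the ideal\<close>

lemma I_B_gen: "g \<in> I_B_gens n \<Longrightarrow> g \<in> I_B n"
  using ring.genideal_self[OF cring.axioms(1)[OF cring_poly_ring] I_B_gens_carrier]
  unfolding I_B_def by blast

lemma I_B_mult: "a \<in> I_B n \<Longrightarrow> x \<in> carrier (poly_ring n) \<Longrightarrow> x * a \<in> I_B n"
  using ideal.I_l_closed[OF ideal_I_B, of a n x] by (simp add: poly_ring_def)

lemma add_subgroup_I_B: "add_subgroup (I_B n)"
proof
  show "0 \<in> I_B n"
    using additive_subgroup.zero_closed[OF ideal.axioms(1)[OF ideal_I_B]] by (simp add: poly_ring_def)
  fix x y assume xy: "x \<in> I_B n" "y \<in> I_B n"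
  have "Const (- 1) * y \<in> I_B n" using I_B_mult[OF xy(2) Const_carrier] .
  moreover have "Const (- 1) * y = - y" by (simp add: Const_def single_uminus)
  ultimately have "x + (- y) \<in> I_B n"
    using additive_subgroup.a_closed[OF ideal.axioms(1)[OF ideal_I_B] xy(1), of "- y"]
    by (simp add: poly_ring_def)
  then show "x - y \<in> I_B n" by simp
qed

lemma X_cube_mem: "i \<in> {1..n} \<Longrightarrow> j \<in> {1..n} \<Longrightarrow> X i j ^ 3 \<in> I_B n"
  by (intro I_B_gen) (unfold I_B_gens_def, blast)

lemma X_mult_row_mem:
  assumes "i \<in> {1..n}" "j \<in> {1..n}" "j' \<in> {1..n}" "j \<noteq> j'"
  shows "X i j * X i j' \<in> I_B n"
proof (cases "j < j'")
  case True
  then show ?thesis using assms by (intro I_B_gen) (unfold I_B_gens_def, blast)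
next
  case False
  then have "j' < j" using assms(4) by simp
  then have "X i j' * X i j \<in> I_B n" using assms by (intro I_B_gen) (unfold I_B_gens_def, blast)
  then show ?thesis by (simp add: mult.commute)
qed

lemma X_mult_col_mem:
  assumes "i \<in> {1..n}" "i' \<in> {1..n}" "j \<in> {1..n}" "i \<noteq> i'"
  shows "X i j * X i' j \<in> I_B n"
proof (cases "i < i'")
  case True
  then show ?thesis using assms by (intro I_B_gen) (unfold I_B_gens_def, blast)
next
  case False
  then have "i' < i" using assms(4) by simp
  then have "X i' j * X i j \<in> I_B n" using assms by (intro I_B_gen) (unfold I_B_gens_def, blast)
  then show ?thesis by (simp add: mult.commute)
qed

lemma sum_squares_row_mem: "i \<in> {1..n} \<Longrightarrow> (\<Sum>j = 1..n. X i j ^ 2) \<in> I_B n"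
  by (intro I_B_gen) (unfold I_B_gens_def, blast)

lemma sum_squares_col_mem: "j \<in> {1..n} \<Longrightarrow> (\<Sum>i = 1..n. X i j ^ 2) \<in> I_B n"
  by (intro I_B_gen) (unfold I_B_gens_def, blast)

section \<open>Row and column relations for placement monomials\<close>

text \<open>\<open>A\<close> carries exponent one and \<open>B\<close> exponent two, as in
  \<open>shadow_monom n w\<close> with \<open>A = neg n w\<close> and
  \<open>B = shadow_set (pos n w)\<close>.\<close>

definition placement_monom :: "(nat \<times> nat) set \<Rightarrow> (nat \<times> nat) set \<Rightarrow> cpoly" where
  "placement_monom A B = monom_of A * monom_of B ^ 2"

lemma placement_monom_carrier:
  "A \<subseteq> {1..n} \<times> {1..n} \<Longrightarrow> B \<subseteq> {1..n} \<times> {1..n} \<Longrightarrow> placement_monom A B \<in> carrier (poly_ring n)"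
  unfolding placement_monom_def by (intro mult_carrier pow_carrier monom_of_carrier)

lemma placement_monom_insert:
  "finite B \<Longrightarrow> (i, j) \<notin> B \<Longrightarrow> placement_monom A (insert (i, j) B) = placement_monom A B * X i j ^ 2"
  unfolding placement_monom_def by (simp add: monom_of_insert power_mult_distrib mult_ac)

lemma placement_monom_factor:
  assumes AB: "A \<subseteq> {1..n} \<times> {1..n}" "B \<subseteq> {1..n} \<times> {1..n}" and ij: "(i, j) \<in> A \<union> B"
  shows "\<exists>N\<in>carrier (poly_ring n). placement_monom A B = N * X i j"
proof -
  have fin: "finite A" "finite B" using AB finite_subset by blast+
  have c: "monom_of (S - {(i, j)}) \<in> carrier (poly_ring n)" if "S \<subseteq> {1..n} \<times> {1..n}" for S
    using that by (intro monom_of_carrier) auto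
  show ?thesis
  proof (cases "(i, j) \<in> A")
    case True
    then have "placement_monom A B = (monom_of (A - {(i, j)}) * monom_of B ^ 2) * X i j"
      unfolding placement_monom_def by (simp add: monom_of_remove[OF fin(1)] mult_ac)
    then show ?thesis using AB by (blast intro: mult_carrier pow_carrier monom_of_carrier c)
  next
    case False
    then have B: "(i, j) \<in> B" using ij by simp
    then have "X i j \<in> carrier (poly_ring n)" using AB(2) by (intro X_carrier) blast+
    moreover have "placement_monom A B = (monom_of A * (X i j * monom_of (B - {(i, j)}) ^ 2)) * X i j"
      unfolding placement_monom_def monom_of_remove[OF fin(2) B]
      by (simp add: power2_eq_square mult_ac)
    ultimately show ?thesis using AB by (blast intro: mult_carrier pow_carrier monom_of_carrier c)
  qed
qed

text \<open>One factor of the square pairs with the factor \<open>X k l\<close> of the monomial, and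
  their product is in the ideal.\<close>

lemma placement_monom_square_mem:
  assumes AB: "A \<subseteq> {1..n} \<times> {1..n}" "B \<subseteq> {1..n} \<times> {1..n}"
    and kl: "(k, l) \<in> A \<union> B" and X: "X k l * X i j \<in> I_B n"
    and ij: "i \<in> {1..n}" "j \<in> {1..n}"
  shows "placement_monom A B * X i j ^ 2 \<in> I_B n"
proof -
  obtain N where N: "N \<in> carrier (poly_ring n)" "placement_monom A B = N * X k l"
    using placement_monom_factor[OF AB kl] by blast
  have "(N * X i j) * (X k l * X i j) \<in> I_B n"
    by (rule I_B_mult[OF X]) (intro mult_carrier N(1) X_carrier ij)
  then show ?thesis unfolding N(2) by (simp add: power2_eq_square mult_ac)
qed

text \<open>Multiply the sum of squares of row \<open>i\<close> by the monomial of \<open>A\<close>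
  and \<open>B\<close>: occupied columns contribute products of two variables in one column, which
  lie in the ideal, and only the free columns survive.\<close>

lemma placement_row_relation:
  assumes AB: "A \<subseteq> {1..n} \<times> {1..n}" "B \<subseteq> {1..n} \<times> {1..n}"
    and i: "i \<in> {1..n}" "i \<notin> fst ` (A \<union> B)"
  shows "(\<Sum>j\<in>{1..n} - snd ` (A \<union> B). placement_monom A (insert (i, j) B)) \<in> I_B n"
proof -
  interpret add_subgroup "I_B n" by (rule add_subgroup_I_B)
  let ?M = "placement_monom A B" and ?J = "snd ` (A \<union> B)"
  have J: "?J \<subseteq> {1..n}" using AB by auto
  have finB: "finite B" using AB finite_subset by blast
  have 1: "?M * (\<Sum>j = 1..n. X i j ^ 2) \<in> I_B n"
    using i AB by (intro I_B_mult sum_squares_row_mem placement_monom_carrier)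
  have 2: "(\<Sum>j\<in>?J. ?M * X i j ^ 2) \<in> I_B n"
  proof (rule sum_mem)
    fix j assume "j \<in> ?J"
    then obtain k where k: "(k, j) \<in> A \<union> B" by (metis imageE prod.collapse)
    then have "k \<in> {1..n}" "j \<in> {1..n}" using AB by blast+
    moreover have "k \<noteq> i" using imageI[OF k, of fst] i(2) by auto
    ultimately show "?M * X i j ^ 2 \<in> I_B n"
      using i by (intro placement_monom_square_mem[OF AB k] X_mult_col_mem) auto
  qed
  have "(\<Sum>j = 1..n. ?M * X i j ^ 2)
      = (\<Sum>j\<in>{1..n} - ?J. ?M * X i j ^ 2) + (\<Sum>j\<in>?J. ?M * X i j ^ 2)"
    using J by (intro sum.subset_diff) auto
  then have "(\<Sum>j\<in>{1..n} - ?J. ?M * X i j ^ 2) \<in> I_B n"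
    using diff_mem[OF 1 2] by (simp add: sum_distrib_left)
  moreover have "placement_monom A (insert (i, j) B) = ?M * X i j ^ 2" for j
    using i(2) imageI[of "(i, j)" "A \<union> B" fst] by (intro placement_monom_insert finB) auto
  ultimately show ?thesis by simp
qed

lemma placement_col_relation:
  assumes AB: "A \<subseteq> {1..n} \<times> {1..n}" "B \<subseteq> {1..n} \<times> {1..n}"
    and j: "j \<in> {1..n}" "j \<notin> snd ` (A \<union> B)"
  shows "(\<Sum>i\<in>{1..n} - fst ` (A \<union> B). placement_monom A (insert (i, j) B)) \<in> I_B n"
proof -
  interpret add_subgroup "I_B n" by (rule add_subgroup_I_B)
  let ?M = "placement_monom A B" and ?J = "fst ` (A \<union> B)"
  have J: "?J \<subseteq> {1..n}" using AB by auto
  have finB: "finite B" using AB finite_subset by blast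
  have 1: "?M * (\<Sum>i = 1..n. X i j ^ 2) \<in> I_B n"
    using j AB by (intro I_B_mult sum_squares_col_mem placement_monom_carrier)
  have 2: "(\<Sum>i\<in>?J. ?M * X i j ^ 2) \<in> I_B n"
  proof (rule sum_mem)
    fix i assume "i \<in> ?J"
    then obtain k where k: "(i, k) \<in> A \<union> B" by (metis imageE prod.collapse)
    then have "k \<in> {1..n}" "i \<in> {1..n}" using AB by blast+
    moreover have "k \<noteq> j" using imageI[OF k, of snd] j(2) by auto
    ultimately show "?M * X i j ^ 2 \<in> I_B n"
      using j by (intro placement_monom_square_mem[OF AB k] X_mult_row_mem) auto
  qed
  have "(\<Sum>i = 1..n. ?M * X i j ^ 2)
      = (\<Sum>i\<in>{1..n} - ?J. ?M * X i j ^ 2) + (\<Sum>i\<in>?J. ?M * X i j ^ 2)"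
    using J by (intro sum.subset_diff) auto
  then have "(\<Sum>i\<in>{1..n} - ?J. ?M * X i j ^ 2) \<in> I_B n"
    using diff_mem[OF 1 2] by (simp add: sum_distrib_left)
  moreover have "placement_monom A (insert (i, j) B) = ?M * X i j ^ 2" for i
    using j(2) imageI[of "(i, j)" "A \<union> B" snd] by (intro placement_monom_insert finB) auto
  ultimately show ?thesis by simp
qed

section \<open>Reduction of arbitrary monomials to placements\<close>

text \<open>An exponent of at least three, or two variables in a common row or column, puts the
  monomial into the ideal. Otherwise its support is a rook placement, split by the exponents one and
  two.\<close>

lemma monomial_cases:
  assumes e: "Poly_Mapping.keys e \<subseteq> {1..n} \<times> {1..n}"
  shows "Poly_Mapping.single e 1 \<in> I_B n \<or>
    (\<exists>A B. A \<union> B \<subseteq> {1..n} \<times> {1..n} \<and> A \<inter> B = {} \<and> rook (A \<union> B) \<and>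
      Poly_Mapping.single e 1 = placement_monom A B)"
proof -
  let ?K = "Poly_Mapping.keys e" and ?x = "\<lambda>p. X (fst p) (snd p)" and ?l = "Poly_Mapping.lookup e"
  have xc: "?x p \<in> carrier (poly_ring n)" if "p \<in> ?K" for p
    using e that by (intro X_carrier) auto
  have pc: "(\<Prod>p\<in>S. ?x p ^ ?l p) \<in> carrier (poly_ring n)" if "S \<subseteq> ?K" for S
    using that xc by (intro prod_carrier pow_carrier) auto
  \<comment> \<open>Phrasing the pair case by membership in the ideal treats common rows and common
    columns at once.\<close>
  consider (cube) p where "p \<in> ?K" "?l p \<ge> 3"
    | (pair) p q where "p \<in> ?K" "q \<in> ?K" "p \<noteq> q" "?x p * ?x q \<in> I_B n"
    | (rook) "\<And>p. p \<in> ?K \<Longrightarrow> ?l p < 3"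
        "\<And>p q. p \<in> ?K \<Longrightarrow> q \<in> ?K \<Longrightarrow> p \<noteq> q \<Longrightarrow> ?x p * ?x q \<notin> I_B n"
    by force
  then show ?thesis
  proof cases
    case cube
    have "?x p ^ ?l p = ?x p ^ (?l p - 3) * ?x p ^ 3"
      using cube(2) by (simp flip: power_add)
    then have "Poly_Mapping.single e 1 = ((\<Prod>p\<in>?K - {p}. ?x p ^ ?l p) * ?x p ^ (?l p - 3)) * ?x p ^ 3"
      unfolding monomial_eq_prod using prod.remove[of ?K p "\<lambda>p. ?x p ^ ?l p"] cube(1)
      by (simp add: mult_ac)
    moreover have "\<dots> \<in> I_B n"
      using e cube(1) by (intro I_B_mult X_cube_mem mult_carrier pow_carrier pc xc) auto
    ultimately show ?thesis by simp
  next
    case pair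
    have pos: "?x r ^ ?l r = ?x r ^ (?l r - 1) * ?x r" if "r \<in> ?K" for r
      using that by (cases "?l r") (simp_all add: in_keys_iff)
    have "Poly_Mapping.single e 1 = ?x p ^ ?l p * (?x q ^ ?l q * (\<Prod>p\<in>?K - {p} - {q}. ?x p ^ ?l p))"
      unfolding monomial_eq_prod using pair
      by (simp add: prod.remove[of ?K p] prod.remove[of "?K - {p}" q])
    also have "\<dots> = (?x p ^ (?l p - 1) * (?x q ^ (?l q - 1) * (\<Prod>p\<in>?K - {p} - {q}. ?x p ^ ?l p))) * (?x p * ?x q)"
      unfolding pos[OF pair(1)] pos[OF pair(2)] by (simp only: mult_ac)
    also have "\<dots> \<in> I_B n"
      using pair by (intro I_B_mult pair(4) mult_carrier pow_carrier pc xc) auto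
    finally show ?thesis by simp
  next
    case rook
    define A where "A = {p \<in> ?K. ?l p = 1}"
    define B where "B = {p \<in> ?K. ?l p = 2}"
    have l: "?l p = 1 \<or> ?l p = 2" if "p \<in> ?K" for p
    proof -
      have "?l p \<noteq> 0" using that by (simp add: in_keys_iff)
      then show ?thesis using rook(1)[OF that] by linarith
    qed
    have K: "?K = A \<union> B" "A \<inter> B = {}" using l by (auto simp: A_def B_def)
    have rk: "rook ?K"
    proof (rule rookI)
      fix i j j' assume ij: "(i, j) \<in> ?K" "(i, j') \<in> ?K"
      show "j = j'"
      proof (rule ccontr)
        assume "j \<noteq> j'"
        then have "X i j * X i j' \<in> I_B n" using ij e by (intro X_mult_row_mem) auto
        then show False using rook(2)[OF ij] \<open>j \<noteq> j'\<close> by simp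
      qed
    next
      fix i i' j assume ij: "(i, j) \<in> ?K" "(i', j) \<in> ?K"
      show "i = i'"
      proof (rule ccontr)
        assume "i \<noteq> i'"
        then have "X i j * X i' j \<in> I_B n" using ij e by (intro X_mult_col_mem) auto
        then show False using rook(2)[OF ij] \<open>i \<noteq> i'\<close> by simp
      qed
    qed
    have fin: "finite A" "finite B" by (simp_all add: A_def B_def)
    have "Poly_Mapping.single e 1 = (\<Prod>p\<in>A. ?x p ^ ?l p) * (\<Prod>p\<in>B. ?x p ^ ?l p)"
      unfolding monomial_eq_prod K(1) by (rule prod.union_disjoint[OF fin K(2)])
    also have "(\<Prod>p\<in>A. ?x p ^ ?l p) = monom_of A"
      unfolding monom_of_def by (intro prod.cong) (auto simp: A_def)
    also have "(\<Prod>p\<in>B. ?x p ^ ?l p) = monom_of B ^ 2"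
      unfolding monom_of_def prod_power_distrib by (intro prod.cong) (auto simp: B_def)
    finally show ?thesis using e rk K unfolding placement_monom_def by metis
  qed
qed

section \<open>Full placements as signed permutations\<close>

lemma rook_permutes:
  assumes "rook P" "fst ` P = N" "snd ` P = N"
  shows "\<exists>\<sigma>. \<sigma> permutes N \<and> P = {(i, \<sigma> i) | i. i \<in> N}"
proof -
  define \<sigma> where "\<sigma> = (\<lambda>i. if i \<in> N then snd (the_inv_into P fst i) else i)"
  have bij: "bij_betw fst P N" "bij_betw snd P N"
    using assms by (auto simp: rook_def bij_betw_def)
  have "bij_betw (snd \<circ> the_inv_into P fst) N N"
    using bij_betw_trans[OF bij_betw_the_inv_into[OF bij(1)] bij(2)] .
  then have "bij_betw \<sigma> N N"
    by (rule bij_betw_cong[THEN iffD1, rotated]) (simp add: \<sigma>_def)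
  then have "\<sigma> permutes N"
    by (rule bij_imp_permutes) (simp add: \<sigma>_def)
  moreover have \<sigma>P: "\<sigma> (fst p) = snd p" if "p \<in> P" for p
    using that assms the_inv_into_f_f[of fst P p] by (auto simp: \<sigma>_def rook_def)
  have "P = {(i, \<sigma> i) | i. i \<in> N}"
  proof
    show "P \<subseteq> {(i, \<sigma> i) | i. i \<in> N}"
    proof
      fix p assume "p \<in> P"
      then have "p = (fst p, \<sigma> (fst p))" "fst p \<in> N" using \<sigma>P assms(2) by auto
      then show "p \<in> {(i, \<sigma> i) | i. i \<in> N}" by blast
    qed
    show "{(i, \<sigma> i) | i. i \<in> N} \<subseteq> P"
      using \<sigma>P assms(2) by force
  qed
  ultimately show ?thesis by blast
qed

lemma ex_signed_perm:
  assumes "rook (A \<union> W)" "A \<inter> W = {}" "fst ` (A \<union> W) = {1..n}" "snd ` (A \<union> W) = {1..n}"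
  shows "\<exists>w\<in>signed_perms n. neg n w = A \<and> pos n w = W"
proof -
  obtain \<sigma> where \<sigma>: "\<sigma> permutes {1..n}" "A \<union> W = {(i, \<sigma> i) | i. i \<in> {1..n}}"
    using rook_permutes[OF assms(1,3,4)] by blast
  \<comment> \<open>\<open>neg\<close> and \<open>pos\<close> read the sign at the column
    \<open>\<sigma> i\<close>, so it is defined by columns. A column of a rook placement holds only
    one point, so the sign still tells which points lie in \<open>A\<close>.\<close>
  define \<kappa> where "\<kappa> = restrict (\<lambda>j. if j \<in> snd ` A then 1 else 0 :: nat) {1..n}"
  have \<kappa>: "\<kappa> (snd p) = (if p \<in> A then 1 else 0)" if "p \<in> A \<union> W" for p
  proof -
    have "snd p \<in> {1..n}" using that assms(4) by blast
    moreover have "snd p \<in> snd ` A \<longleftrightarrow> p \<in> A"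
      using assms(1) that by (auto simp: rook_def dest: inj_onD)
    ultimately show ?thesis by (simp add: \<kappa>_def)
  qed
  have "(\<sigma>, \<kappa>) \<in> signed_perms n"
    using \<sigma>(1) by (auto simp: signed_perms_def \<kappa>_def)
  moreover have "neg n (\<sigma>, \<kappa>) = {p \<in> A \<union> W. \<kappa> (snd p) = 1}" "pos n (\<sigma>, \<kappa>) = {p \<in> A \<union> W. \<kappa> (snd p) = 0}"
    unfolding neg_def pos_def \<sigma>(2) by auto
  moreover have "{p \<in> A \<union> W. \<kappa> (snd p) = 1} = A" "{p \<in> A \<union> W. \<kappa> (snd p) = 0} = W"
  proof -
    have "\<kappa> (snd p) = 1" "\<kappa> (snd p) \<noteq> 0" if "p \<in> A" for p using \<kappa>[of p] that by auto
    moreover have "\<kappa> (snd p) = 0" "\<kappa> (snd p) \<noteq> 1" if "p \<in> W" for p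
      using \<kappa>[of p] that assms(2) by auto
    ultimately show "{p \<in> A \<union> W. \<kappa> (snd p) = 1} = A" "{p \<in> A \<union> W. \<kappa> (snd p) = 0} = W" by blast+
  qed
  ultimately show ?thesis by metis
qed

text \<open>With \<open>A\<close> fixed, the rows and columns it leaves free form the grid
  \<open>R \<times> C\<close> on which \<open>placement_monom A\<close> satisfies the relations
  required by \<open>rook_placement_mem\<close>.\<close>

lemma placement_monom_mem:
  assumes V: "add_subgroup V" "I_B n \<subseteq> V"
    and shadow: "\<And>w. w \<in> signed_perms n \<Longrightarrow> shadow_monom n w \<in> V"
    and AB: "A \<union> B \<subseteq> {1..n} \<times> {1..n}" "A \<inter> B = {}" "rook (A \<union> B)"
  shows "placement_monom A B \<in> V"
proof -
  define R where "R = {1..n} - fst ` A"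
  define C where "C = {1..n} - snd ` A"
  have A: "A \<subseteq> {1..n} \<times> {1..n}" "rook A" and B: "rook B"
    using AB rook_subset[OF AB(3)] by auto
  have imA: "fst ` A \<subseteq> {1..n}" "snd ` A \<subseteq> {1..n}" using A by auto
  have finA: "finite A" using A finite_subset by blast
  have card: "card R = card C"
    unfolding R_def C_def using imA finA card_fst_rook[OF A(2)] card_snd_rook[OF A(2)]
    by (simp add: card_Diff_subset)
  have sub: "P \<subseteq> {1..n} \<times> {1..n}" if "P \<subseteq> R \<times> C" for P
    using that by (auto simp: R_def C_def)
  have diff: "C - snd ` P = {1..n} - snd ` (A \<union> P)" "R - fst ` P = {1..n} - fst ` (A \<union> P)" for P
    by (auto simp: R_def C_def)
  show ?thesis
  proof (rule add_subgroup.rook_placement_mem[OF V(1), where R = R and C = C])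
    show "(\<Sum>j\<in>C - snd ` P. placement_monom A (insert (i, j) P)) \<in> V"
      if "P \<subseteq> R \<times> C" "rook P" "i \<in> R - fst ` P" for P i
      using placement_row_relation[OF A(1) sub[OF that(1)], of i] that V(2) unfolding diff by blast
    show "(\<Sum>i\<in>R - fst ` P. placement_monom A (insert (i, j) P)) \<in> V"
      if "P \<subseteq> R \<times> C" "rook P" "j \<in> C - snd ` P" for P j
      using placement_col_relation[OF A(1) sub[OF that(1)], of j] that V(2) unfolding diff by blast
    show "placement_monom A (shadow_set W) \<in> V"
      if W: "W \<subseteq> R \<times> C" "rook W" "fst ` W = R" "snd ` W = C" for W
    proof -
      have d: "fst ` A \<inter> fst ` W = {}" "snd ` A \<inter> snd ` W = {}"
        unfolding W by (auto simp: R_def C_def)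
      have "fst ` (A \<union> W) = {1..n}" "snd ` (A \<union> W) = {1..n}"
        unfolding image_Un W(3,4) using imA by (auto simp: R_def C_def)
      moreover have "A \<inter> W = {}" using d by blast
      \<comment> \<open>Taking \<open>A\<close> as the negative part completes \<open>W\<close> to a
        signed permutation.\<close>
      ultimately obtain w where "w \<in> signed_perms n" "neg n w = A" "pos n w = W"
        using ex_signed_perm rook_Un[OF A(2) W(2) d] by blast
      then show ?thesis
        using shadow[of w] by (simp add: shadow_monom_def placement_monom_def)
    qed
    have "fst ` A \<inter> fst ` B = {}" "snd ` A \<inter> snd ` B = {}"
      using AB(2,3) unfolding rook_def inj_on_def by blast+
    moreover have "fst p \<in> R \<and> snd p \<in> C" if "p \<in> B" for p
      using that AB(1) calculation imageI[OF that, of fst] imageI[OF that, of snd]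
      by (auto simp: R_def C_def)
    ultimately show "B \<subseteq> R \<times> C" by (auto simp: mem_Times_iff)
  qed (use B card in \<open>simp_all add: R_def C_def\<close>)
qed

section \<open>From monomials to the quotient space\<close>

text \<open>Every polynomial is a scalar combination of monomials, each of which lies in the ideal
  or is a placement monomial.\<close>

lemma poly_mem:
  assumes V: "add_subgroup V" "I_B n \<subseteq> V"
    and shadow: "\<And>w. w \<in> signed_perms n \<Longrightarrow> shadow_monom n w \<in> V"
    and scale: "\<And>c p. p \<in> V \<Longrightarrow> Const c * p \<in> V"
    and p: "p \<in> carrier (poly_ring n)"
  shows "p \<in> V"
proof -
  have "Poly_Mapping.single e (Poly_Mapping.lookup p e) \<in> V" if "e \<in> Poly_Mapping.keys p" for e
  proof -
    have "Poly_Mapping.keys e \<subseteq> {1..n} \<times> {1..n}" using p that by (simp add: poly_ring_def)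
    then have "Poly_Mapping.single e 1 \<in> V"
      using monomial_cases[of e n] V(2) placement_monom_mem[OF V shadow] by auto
    then show ?thesis
      using scale[of "Poly_Mapping.single e 1" "Poly_Mapping.lookup p e"] by (simp add: Const_def mult_single)
  qed
  then have "(\<Sum>e\<in>Poly_Mapping.keys p. Poly_Mapping.single e (Poly_Mapping.lookup p e)) \<in> V"
    by (rule add_subgroup.sum_mem[OF V(1)])
  then show ?thesis by (simp add: poly_mapping_sum_single)
qed

theorem theorem3p9:
  fixes n :: nat
  assumes "n \<ge> 1"
  shows "LinearCombinations.module.span class_ring (quot_B n)
           ((\<lambda>w. I_B n +>\<^bsub>poly_ring n\<^esub> shadow_monom n w) ` signed_perms n)
         = carrier (quot_B n)"
proof -
  interpret I: ideal "I_B n" "poly_ring n" by (rule ideal_I_B)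
  interpret Q: vectorspace class_ring "quot_B n" by (rule vectorspace_quot_B)
  let ?q = "\<lambda>p. I_B n +>\<^bsub>poly_ring n\<^esub> p"
  let ?S = "(\<lambda>w. ?q (shadow_monom n w)) ` signed_perms n"
  \<comment> \<open>Passing to the preimage of the span replaces computations with cosets by
    computations with polynomials.\<close>
  define V where "V = {p \<in> carrier (poly_ring n). ?q p \<in> Q.span ?S}"
  have carrier: "carrier (quot_B n) = ?q ` carrier (poly_ring n)"
    by (auto simp: quot_B_def Let_def FactRing_def A_RCOSETS_def')
  have S: "?S \<subseteq> carrier (quot_B n)"
    unfolding carrier using shadow_monom_carrier by blast
  interpret span: submodule class_ring "Q.span ?S" "quot_B n"
    by (rule Q.span_is_submodule[OF S])
  have add: "p + p' \<in> V" if "p \<in> V" "p' \<in> V" for p p'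
  proof -
    have "?q (p + p') = ?q p \<oplus>\<^bsub>quot_B n\<^esub> ?q p'"
      using ring_hom_add[OF I.rcos_ring_hom, of p p'] that
      by (simp add: V_def quot_B_def Let_def poly_ring_def)
    then show ?thesis using that span.m_closed by (auto simp: V_def intro: add_carrier)
  qed
  have scale: "Const c * p \<in> V" if "p \<in> V" for c p
  proof -
    have "?q (Const c * p) = c \<odot>\<^bsub>quot_B n\<^esub> ?q p"
      using ring_hom_mult[OF I.rcos_ring_hom Const_carrier, of p c] that
      by (simp add: V_def quot_B_def Let_def) (simp add: poly_ring_def)
    then show ?thesis
      using that span.smult_closed[of c "?q p"] by (auto simp: V_def intro: mult_carrier Const_carrier)
  qed
  have I: "I_B n \<subseteq> V"
  proof
    fix p assume p: "p \<in> I_B n"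
    have "?q p = \<zero>\<^bsub>quot_B n\<^esub>"
      using I.a_rcos_const[OF p] by (simp add: quot_B_def Let_def FactRing_def)
    then show "p \<in> V" using I.Icarr[OF p] by (simp add: V_def)
  qed
  have "add_subgroup V"
  proof
    show "0 \<in> V" using I add_subgroup.zero_mem[OF add_subgroup_I_B] by blast
    fix x y assume xy: "x \<in> V" "y \<in> V"
    have "x + Const (- 1) * y = x - y" by (simp add: Const_def single_uminus)
    then show "x - y \<in> V" using add[OF xy(1) scale[OF xy(2), of "- 1"]] by metis
  qed
  moreover have "shadow_monom n w \<in> V" if "w \<in> signed_perms n" for w
    using that Q.in_own_span[OF S] shadow_monom_carrier by (auto simp: V_def)
  ultimately have "carrier (poly_ring n) \<subseteq> V"
    using poly_mem I scale by blast
  then have "carrier (quot_B n) \<subseteq> Q.span ?S"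
    unfolding carrier by (auto simp: V_def)
  then show ?thesis using span.subset by blast
qed

end
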